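(* Let $q\ge 1$ and let $h$ be a sharing function that is concave in its first argument (i.e. $g\mapsto h(g,w)-h(g-1,w)$ is non-increasing for every $w$). Given a coloring game $G=(V,w)$ with weights in $\{-\infty\}\cup\mathbb{N}$, one can construct a coloring game $G'$ such that from any partition of the players of $G'$ maximizing the global utility one can deduce, in linear time, a configuration with $q$ channels for $G$ maximizing the global utility.
   Context: A coloring game $G=(V,w)$ has a finite set of players $V$ and symmetric weights $w_{uv}=w_{vu}$ ($-\infty$ means enemies). For a partition $P$ of $V$ with $X(u)$ the group of $u$, $f_u(P)=\sum_{v\in X(u)\setminus\{u\}} w_{uv}$ and $f(P)=\sum_u f_u(P)$; a maximum partition maximizes $f$. A configuration with $q$ channels is a multiset $C$ of groups (subsets of $V$, possibly singletons or empty) such that each player belongs to exactly $q$ groups of $C$ counted with multiplicity; $X(u)$ is the multiset of groups containing $u$ and $|X(u)\cap X(v)|$ the number of groups of $C$ containing both $u$ and $v$. Given a function $h:\mathbb{N}\times(\mathbb{Z}\cup\{-\infty\})\to\mathbb{R}\cup\{-\infty\}$ with $h(0,\cdot)=0$, $h(\cdot,0)=0$, $h(1,w)=w$, $w\mapsto h(g,w)$ non-decreasing for each $g$, and $g\mapsto w\cdot h(g,w)$ non-decreasing for each $w$, the utility is $f_u(C)=\sum_{v\in V\setminus\{u\}} h(|X(u)\cap X(v)|,w_{uv})$ and $f(C)=\sum_u f_u(C)$; a maximum configuration with $q$ channels maximizes $f$. The game $G'$ may use real weights. *)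

theory Defs
  imports
    "HOL-Library.Extended_Real"
    "HOL-Library.Multiset"
    "HOL-Library.Disjoint_Sets"
    "HOL-Library.More_List"
begin

section \<open>Coloring games and partitions\<close>

text \<open>
  Weights live in \<^typ>\<open>ereal\<close>; the value \<^term>\<open>\<infinity>\<close> is excluded wherever it could occur, so the
  real line together with \<^term>\<open>-\<infinity>\<close> remains. The weight of a player with itself is irrelevant
  and left unconstrained.
\<close>

definition coloring_game :: "'a set \<Rightarrow> ('a \<Rightarrow> 'a \<Rightarrow> ereal) \<Rightarrow> bool" where
  "coloring_game V w \<longleftrightarrow>
     finite V \<and> (\<forall>u\<in>V. \<forall>v\<in>V. u \<noteq> v \<longrightarrow> w u v = w v u \<and> w u v \<noteq> \<infinity>)"

definition weights_in :: "ereal set \<Rightarrow> 'a set \<Rightarrow> ('a \<Rightarrow> 'a \<Rightarrow> ereal) \<Rightarrow> bool" where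
  "weights_in W V w \<longleftrightarrow> (\<forall>u\<in>V. \<forall>v\<in>V. u \<noteq> v \<longrightarrow> w u v \<in> W)"

definition nat_weights :: "ereal set" where
  "nat_weights = insert (-\<infinity>) (range (\<lambda>n::nat. ereal (real n)))"

definition int_weights :: "ereal set" where
  "int_weights = insert (-\<infinity>) (range (\<lambda>z::int. ereal (real_of_int z)))"

definition group_of :: "'a set set \<Rightarrow> 'a \<Rightarrow> 'a set" where
  "group_of P u = (THE X. X \<in> P \<and> u \<in> X)"

definition partition_utility :: "('a \<Rightarrow> 'a \<Rightarrow> ereal) \<Rightarrow> 'a set set \<Rightarrow> 'a \<Rightarrow> ereal" where
  "partition_utility w P u = (\<Sum>v\<in>group_of P u - {u}. w u v)"

definition global_partition_utility ::
    "'a set \<Rightarrow> ('a \<Rightarrow> 'a \<Rightarrow> ereal) \<Rightarrow> 'a set set \<Rightarrow> ereal" where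
  "global_partition_utility V w P = (\<Sum>u\<in>V. partition_utility w P u)"

definition maximum_partition :: "'a set \<Rightarrow> ('a \<Rightarrow> 'a \<Rightarrow> ereal) \<Rightarrow> 'a set set \<Rightarrow> bool" where
  "maximum_partition V w P \<longleftrightarrow>
     partition_on V P \<and>
     (\<forall>Q. partition_on V Q \<longrightarrow> global_partition_utility V w Q \<le> global_partition_utility V w P)"


section \<open>Sharing functions and configurations\<close>

definition sharing_function :: "(nat \<Rightarrow> ereal \<Rightarrow> ereal) \<Rightarrow> bool" where
  "sharing_function h \<longleftrightarrow>
     (\<forall>g. \<forall>w\<in>int_weights. h g w \<noteq> \<infinity>) \<and>
     (\<forall>w\<in>int_weights. h 0 w = 0) \<and>
     (\<forall>g. h g 0 = 0) \<and>
     (\<forall>w\<in>int_weights. h 1 w = w) \<and>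
     (\<forall>g. mono_on int_weights (h g)) \<and>
     (\<forall>w\<in>int_weights. mono (\<lambda>g. w * h g w))"

text \<open>
  The increment \<^term>\<open>h (Suc g) w - h g w\<close>, with the convention that going from \<^term>\<open>-\<infinity>\<close> to
  \<^term>\<open>-\<infinity>\<close> is an increment of \<^term>\<open>-\<infinity>\<close>. The difference on \<^typ>\<open>ereal\<close> would be
  \<^term>\<open>\<infinity>\<close> there, and then no sharing function at all would be concave at \<^term>\<open>w = -\<infinity>\<close>.
\<close>

definition increment :: "(nat \<Rightarrow> ereal \<Rightarrow> ereal) \<Rightarrow> ereal \<Rightarrow> nat \<Rightarrow> ereal" where
  "increment h w g = (if h (Suc g) w = -\<infinity> then -\<infinity> else h (Suc g) w - h g w)"

definition concave_sharing :: "(nat \<Rightarrow> ereal \<Rightarrow> ereal) \<Rightarrow> bool" where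
  "concave_sharing h \<longleftrightarrow> (\<forall>w\<in>int_weights. antimono (increment h w))"

definition groups_of :: "'a set multiset \<Rightarrow> 'a \<Rightarrow> 'a set multiset" where
  "groups_of C u = {#X \<in># C. u \<in> X#}"

definition shared_groups :: "'a set multiset \<Rightarrow> 'a \<Rightarrow> 'a \<Rightarrow> nat" where
  "shared_groups C u v = size {#X \<in># C. u \<in> X \<and> v \<in> X#}"

definition configuration :: "nat \<Rightarrow> 'a set \<Rightarrow> 'a set multiset \<Rightarrow> bool" where
  "configuration q V C \<longleftrightarrow> (\<forall>X\<in>#C. X \<subseteq> V) \<and> (\<forall>u\<in>V. size (groups_of C u) = q)"

definition configuration_utility ::
    "(nat \<Rightarrow> ereal \<Rightarrow> ereal) \<Rightarrow> 'a set \<Rightarrow> ('a \<Rightarrow> 'a \<Rightarrow> ereal) \<Rightarrow> 'a set multiset \<Rightarrow> 'a \<Rightarrow> ereal" where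
  "configuration_utility h V w C u = (\<Sum>v\<in>V - {u}. h (shared_groups C u v) (w u v))"

definition global_configuration_utility ::
    "(nat \<Rightarrow> ereal \<Rightarrow> ereal) \<Rightarrow> 'a set \<Rightarrow> ('a \<Rightarrow> 'a \<Rightarrow> ereal) \<Rightarrow> 'a set multiset \<Rightarrow> ereal" where
  "global_configuration_utility h V w C = (\<Sum>u\<in>V. configuration_utility h V w C u)"

definition maximum_configuration ::
    "nat \<Rightarrow> (nat \<Rightarrow> ereal \<Rightarrow> ereal) \<Rightarrow> 'a set \<Rightarrow> ('a \<Rightarrow> 'a \<Rightarrow> ereal) \<Rightarrow> 'a set multiset \<Rightarrow> bool" where
  "maximum_configuration q h V w C \<longleftrightarrow>
     configuration q V C \<and>
     (\<forall>D. configuration q V D \<longrightarrow>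
        global_configuration_utility h V w D \<le> global_configuration_utility h V w C)"


section \<open>A random access machine with extended reals\<close>

text \<open>
  Programs work on registers holding naturals, on two-dimensional tables of naturals and on
  two-dimensional tables of extended reals (a table is named by a constant of the program).
  The sharing function is available as an oracle, since it is an arbitrary real-valued function.
  Every executed assignment or test costs one step; the expressions of a program have constant
  size. There is no unit-cost multiplication or division, with which polynomially many steps
  would exceed polynomial time, and there are no real constants, which could encode advice.
\<close>

record state =
  reg :: "nat \<Rightarrow> nat"
  ntab :: "nat \<Rightarrow> nat \<Rightarrow> nat \<Rightarrow> nat"
  rtab :: "nat \<Rightarrow> nat \<Rightarrow> nat \<Rightarrow> ereal"

datatype nexp =
    NConst nat
  | Reg nat
  | NTab nat nexp nexp
  | NPlus nexp nexp
  | NMinus nexp nexp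

datatype rexp =
    NegInf
  | OfNat nexp
  | RTab nat nexp nexp
  | RPlus rexp rexp
  | RMinus rexp rexp
  | Share nexp rexp

datatype bexp =
    NLe nexp nexp
  | RLe rexp rexp
  | Neg bexp
  | Conj bexp bexp

datatype com =
    SetReg nat nexp
  | SetNTab nat nexp nexp nexp
  | SetRTab nat nexp nexp rexp
  | Seq com com
  | Cond bexp com com
  | While bexp com

primrec nval :: "nexp \<Rightarrow> state \<Rightarrow> nat" where
  "nval (NConst n) s = n"
| "nval (Reg x) s = reg s x"
| "nval (NTab a i j) s = ntab s a (nval i s) (nval j s)"
| "nval (NPlus d e) s = nval d s + nval e s"
| "nval (NMinus d e) s = nval d s - nval e s"

primrec rval :: "(nat \<Rightarrow> ereal \<Rightarrow> ereal) \<Rightarrow> rexp \<Rightarrow> state \<Rightarrow> ereal" where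
  "rval h NegInf s = -\<infinity>"
| "rval h (OfNat e) s = ereal (real (nval e s))"
| "rval h (RTab a i j) s = rtab s a (nval i s) (nval j s)"
| "rval h (RPlus d e) s = rval h d s + rval h e s"
| "rval h (RMinus d e) s = rval h d s - rval h e s"
| "rval h (Share g e) s = h (nval g s) (rval h e s)"

primrec bval :: "(nat \<Rightarrow> ereal \<Rightarrow> ereal) \<Rightarrow> bexp \<Rightarrow> state \<Rightarrow> bool" where
  "bval h (NLe d e) s \<longleftrightarrow> nval d s \<le> nval e s"
| "bval h (RLe d e) s \<longleftrightarrow> rval h d s \<le> rval h e s"
| "bval h (Neg b) s \<longleftrightarrow> \<not> bval h b s"
| "bval h (Conj b c) s \<longleftrightarrow> bval h b s \<and> bval h c s"

definition set_tab :: "(nat \<Rightarrow> nat \<Rightarrow> nat \<Rightarrow> 'b) \<Rightarrow> nat \<Rightarrow> nat \<Rightarrow> nat \<Rightarrow> 'b \<Rightarrow> nat \<Rightarrow> nat \<Rightarrow> nat \<Rightarrow> 'b" where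
  "set_tab T a i j x = T(a := (T a)(i := (T a i)(j := x)))"

text \<open>
  \<open>exec h c s t s'\<close>: with oracle \<open>h\<close>, program \<open>c\<close> started in state \<open>s\<close> terminates after
  exactly \<open>t\<close> steps in state \<open>s'\<close>.
\<close>

inductive exec ::
    "(nat \<Rightarrow> ereal \<Rightarrow> ereal) \<Rightarrow> com \<Rightarrow> state \<Rightarrow> nat \<Rightarrow> state \<Rightarrow> bool" for h where
  SetReg: "exec h (SetReg x e) s 1 (s\<lparr>reg := (reg s)(x := nval e s)\<rparr>)"
| SetNTab: "exec h (SetNTab a i j e) s 1
     (s\<lparr>ntab := set_tab (ntab s) a (nval i s) (nval j s) (nval e s)\<rparr>)"
| SetRTab: "exec h (SetRTab a i j e) s 1
     (s\<lparr>rtab := set_tab (rtab s) a (nval i s) (nval j s) (rval h e s)\<rparr>)"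
| Seq: "exec h c s t s' \<Longrightarrow> exec h d s' t' s'' \<Longrightarrow> exec h (Seq c d) s (t + t') s''"
| IfTrue: "bval h b s \<Longrightarrow> exec h c s t s' \<Longrightarrow> exec h (Cond b c d) s (Suc t) s'"
| IfFalse: "\<not> bval h b s \<Longrightarrow> exec h d s t s' \<Longrightarrow> exec h (Cond b c d) s (Suc t) s'"
| WhileFalse: "\<not> bval h b s \<Longrightarrow> exec h (While b c) s 1 s"
| WhileTrue: "bval h b s \<Longrightarrow> exec h c s t s' \<Longrightarrow> exec h (While b c) s' t' s'' \<Longrightarrow>
     exec h (While b c) s (Suc (t + t')) s''"

inductive_cases exec_elims:
  "exec h (SetReg x e) s t s'"
  "exec h (SetNTab a i j e) s t s'"
  "exec h (SetRTab a i j e) s t s'"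
  "exec h (Seq c d) s t s'"
  "exec h (Cond b c d) s t s'"
  "exec h (While b c) s t s'"

lemma exec_deterministic:
  "exec h c s t s' \<Longrightarrow> exec h c s u s'' \<Longrightarrow> t = u \<and> s' = s''"
proof (induction arbitrary: u s'' rule: exec.induct)
  case (SetReg x e s) then show ?case by (auto elim: exec_elims(1))
next
  case (SetNTab a i j e s) then show ?case by (auto elim: exec_elims(2))
next
  case (SetRTab a i j e s) then show ?case by (auto elim: exec_elims(3))
next
  case (Seq c s t s' d t' s2)
  show ?case by (rule exec_elims(4)[OF Seq.prems]) (use Seq.IH in blast)
next
  case (IfTrue b s c t s' d)
  show ?case by (rule exec_elims(5)[OF IfTrue.prems]) (use IfTrue.hyps IfTrue.IH in blast)+
next
  case (IfFalse b s d t s' c)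
  show ?case by (rule exec_elims(5)[OF IfFalse.prems]) (use IfFalse.hyps IfFalse.IH in blast)+
next
  case (WhileFalse b s c)
  show ?case by (rule exec_elims(6)[OF WhileFalse.prems]) (use WhileFalse.hyps in auto)
next
  case (WhileTrue b s c t s' t' s2)
  show ?case by (rule exec_elims(6)[OF WhileTrue.prems]) (use WhileTrue.hyps WhileTrue.IH in blast)+
qed


section \<open>Input and output\<close>

text \<open>
  A game whose players are listed as \<open>vs\<close> is presented as the number of players (register 0)
  and the matrix of weights (real table 0), the players being numbered by their position in \<open>vs\<close>.
  The constructed game is read off in the same way, from register 0 and real table 1.
\<close>

definition blank_state :: state where
  "blank_state = \<lparr>reg = (\<lambda>_. 0), ntab = (\<lambda>_ _ _. 0), rtab = (\<lambda>_ _ _. 0)\<rparr>"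

definition game_input :: "'a list \<Rightarrow> ('a \<Rightarrow> 'a \<Rightarrow> ereal) \<Rightarrow> state" where
  "game_input vs w = blank_state
     \<lparr>reg := (\<lambda>_. 0)(0 := length vs),
      rtab := (\<lambda>_ _ _. 0)(0 := (\<lambda>i j. if i < length vs \<and> j < length vs then w (vs ! i) (vs ! j) else 0))\<rparr>"

definition output_size :: "state \<Rightarrow> nat" where
  "output_size s = reg s 0"

definition output_weight :: "state \<Rightarrow> nat \<Rightarrow> nat \<Rightarrow> ereal" where
  "output_weight s = rtab s 1"

text \<open>
  A list of groups, each of them a list of player numbers, is stored in a table: the number of
  groups in cell (0,0), and in row \<^term>\<open>Suc l\<close> the length of group \<open>l\<close> followed by its members.
\<close>

definition table_of_lists :: "nat list list \<Rightarrow> nat \<Rightarrow> nat \<Rightarrow> nat" where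
  "table_of_lists xss i j =
     nth_default 0 (nth_default [] ([length xss] # map (\<lambda>xs. length xs # xs) xss) i) j"

definition lists_of_table :: "(nat \<Rightarrow> nat \<Rightarrow> nat) \<Rightarrow> nat list list" where
  "lists_of_table T = map (\<lambda>l. map (\<lambda>j. T (Suc l) (Suc j)) [0..<T (Suc l) 0]) [0..<T 0 0]"

lemma lists_of_table_of_lists: "lists_of_table (table_of_lists xss) = xss"
  unfolding lists_of_table_def table_of_lists_def
  by (rule nth_equalityI) (auto simp: nth_default_def intro!: nth_equalityI)

text \<open>
  \<open>encodes_groups vs xss C\<close>: the lists \<open>xss\<close> of positions in \<open>vs\<close> spell out, without repeating
  a player inside a group, exactly the multiset \<open>C\<close> of groups.
\<close>

definition encodes_groups :: "'a list \<Rightarrow> nat list list \<Rightarrow> 'a set multiset \<Rightarrow> bool" where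
  "encodes_groups vs xss C \<longleftrightarrow>
     (\<forall>xs\<in>set xss. distinct xs \<and> set xs \<subseteq> {..<length vs}) \<and>
     mset (map (\<lambda>xs. (!) vs ` set xs) xss) = C"

text \<open>
  The procedure that decodes a partition of the constructed game receives the number of players
  of the original game (register 0) and the groups of the partition (table 0). It leaves the
  configuration in table 1.
\<close>

definition partition_input :: "nat \<Rightarrow> nat list list \<Rightarrow> state" where
  "partition_input n xss = blank_state
     \<lparr>reg := (\<lambda>_. 0)(0 := n),
      ntab := (\<lambda>_ _ _. 0)(0 := table_of_lists xss)\<rparr>"

definition output_groups :: "state \<Rightarrow> nat list list" where
  "output_groups s = lists_of_table (ntab s 1)"

end

theory Submission
  imports Defs
begin

text \<open>
  In the constructed game every player \<open>u\<close> has \<open>q\<close> slots, one per channel, which are pairwise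
  enemies; slots of enemies are enemies, other slots are indifferent. Every ordered pair \<open>(u, v)\<close>
  has \<open>q\<close> tokens, again pairwise enemies; the \<open>k\<close>-th one has weight
  \<open>h (Suc k) (w u v) - h k (w u v) \<ge> 0\<close> with each slot of \<open>u\<close> and of \<open>v\<close> (or \<open>0\<close>
  if \<open>u = v\<close> or \<open>u\<close> and \<open>v\<close> are enemies). A token can always
  earn its weight once, by joining a slot of \<open>u\<close>, and it earns it a second time exactly when the
  group also contains a slot of \<open>v\<close>. As the tokens of a pair sit in distinct groups, at most as
  many of them earn twice as \<open>u\<close> and \<open>v\<close> share groups, and by concavity the first ones are the
  most valuable, so together their surplus is at most \<open>h g (w u v)\<close> for \<open>g\<close> shared groups. Every
  configuration attains this bound, so maximum partitions restrict on the slots to maximum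
  configurations.
\<close>

section \<open>Programs with a step bound\<close>

text \<open>Total correctness with a step budget. Since runs are deterministic, exhibiting one run
  says everything about the program. The postcondition may itself be a \<open>terminates\<close>
  claim about the rest of the program, which is how programs are chained.\<close>

definition terminates ::
    "(nat \<Rightarrow> ereal \<Rightarrow> ereal) \<Rightarrow> com \<Rightarrow> state \<Rightarrow> nat \<Rightarrow> (state \<Rightarrow> bool) \<Rightarrow> bool" where
  "terminates h c s T Q \<longleftrightarrow> (\<exists>t s'. exec h c s t s' \<and> t \<le> T \<and> Q s')"

lemma terminates_mono:
  "terminates h c s T Q \<Longrightarrow> T \<le> T' \<Longrightarrow> (\<And>s'. Q s' \<Longrightarrow> Q' s') \<Longrightarrow> terminates h c s T' Q'"
  unfolding terminates_def by (meson order_trans)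

lemma terminates_Seq:
  assumes "terminates h c s T (\<lambda>s'. terminates h d s' T' Q)"
  shows "terminates h (Seq c d) s (T + T') Q"
  using assms unfolding terminates_def by (meson add_mono exec.Seq)

lemma terminates_SetReg [simp]:
  "terminates h (SetReg x e) s T Q \<longleftrightarrow> 1 \<le> T \<and> Q (s\<lparr>reg := (reg s)(x := nval e s)\<rparr>)"
  unfolding terminates_def using exec.SetReg[of h] by (fastforce elim: exec_elims)

lemma terminates_SetNTab [simp]:
  "terminates h (SetNTab a i j e) s T Q \<longleftrightarrow>
     1 \<le> T \<and> Q (s\<lparr>ntab := set_tab (ntab s) a (nval i s) (nval j s) (nval e s)\<rparr>)"
  unfolding terminates_def using exec.SetNTab[of h] by (fastforce elim: exec_elims)

lemma terminates_SetRTab [simp]: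
  "terminates h (SetRTab a i j e) s T Q \<longleftrightarrow>
     1 \<le> T \<and> Q (s\<lparr>rtab := set_tab (rtab s) a (nval i s) (nval j s) (rval h e s)\<rparr>)"
  unfolding terminates_def using exec.SetRTab[of h] by (fastforce elim: exec_elims)

lemma terminates_Cond [simp]:
  "terminates h (Cond b c d) s T Q \<longleftrightarrow>
     1 \<le> T \<and> (if bval h b s then terminates h c s (T - 1) Q else terminates h d s (T - 1) Q)"
proof -
  have "exec h (Cond b c d) s t s' \<longleftrightarrow>
     (\<exists>u. t = Suc u \<and> exec h (if bval h b s then c else d) s u s')" for t s'
    by (auto intro: exec.IfTrue exec.IfFalse elim: exec_elims)
  then show ?thesis
    unfolding terminates_def by (cases T) (auto split: if_splits)
qed

text \<open>Stated as an equivalence so that its instances serve as simplification rules: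
  straight-line code is then executed symbolically, one unit of budget per assignment. The conjunct
  \<open>1 \<le> T\<close> keeps the truncated \<open>T - 1\<close> exact.\<close>

lemma terminates_Seq_step:
  assumes "\<And>t s'. exec h c s t s' \<longleftrightarrow> t = 1 \<and> s' = s1"
  shows "terminates h (Seq c d) s T Q \<longleftrightarrow> 1 \<le> T \<and> terminates h d s1 (T - 1) Q"
proof -
  have "exec h (Seq c d) s t s' \<longleftrightarrow> (\<exists>u. t = Suc u \<and> exec h d s1 u s')" for t s'
    using exec.Seq[of h c s 1 s1 d] assms by (auto elim!: exec_elims(4))
  then show ?thesis
    unfolding terminates_def by (cases T) auto
qed

lemma terminates_Seq_SetReg [simp]:
  "terminates h (Seq (SetReg x e) d) s T Q \<longleftrightarrow>
     1 \<le> T \<and> terminates h d (s\<lparr>reg := (reg s)(x := nval e s)\<rparr>) (T - 1) Q"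
  by (rule terminates_Seq_step) (auto intro: exec.SetReg[simplified] elim: exec_elims)

lemma terminates_Seq_SetNTab [simp]:
  "terminates h (Seq (SetNTab a i j e) d) s T Q \<longleftrightarrow>
     1 \<le> T \<and>
     terminates h d (s\<lparr>ntab := set_tab (ntab s) a (nval i s) (nval j s) (nval e s)\<rparr>) (T - 1) Q"
  by (rule terminates_Seq_step) (auto intro: exec.SetNTab[simplified] elim: exec_elims)

text \<open>The invariant is indexed by the number of completed rounds, and the number
  \<open>m\<close> of rounds is known in advance. Each round pays for one test and its body; the
  outer \<open>Suc\<close> pays for the final failing test.\<close>

lemma terminates_While:
  assumes step: "\<And>k s. k < m \<Longrightarrow> I k s \<Longrightarrow> bval h b s \<and> terminates h c s (T k) (I (Suc k))"
    and stop: "\<And>s. I m s \<Longrightarrow> \<not> bval h b s"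
    and init: "I 0 s"
  shows "terminates h (While b c) s (Suc (\<Sum>k<m. Suc (T k))) (I m)"
proof -
  \<comment> \<open>Generalized to a loop entered with \<open>k\<close> rounds already done, by
    induction on the \<open>m - k\<close> remaining ones.\<close>
  have "k \<le> m \<Longrightarrow> I k s \<Longrightarrow> terminates h (While b c) s (Suc (\<Sum>i=k..<m. Suc (T i))) (I m)" for k s
  proof (induction "m - k" arbitrary: k s)
    case 0
    then have "I m s" by simp
    then show ?case
      unfolding terminates_def using exec.WhileFalse[OF stop] by fastforce
  next
    case (Suc d)
    then have k: "k < m" by simp
    from step[OF k Suc.prems(2)] obtain t s1 where
      1: "bval h b s" "exec h c s t s1" "t \<le> T k" "I (Suc k) s1"
      unfolding terminates_def by blast
    from Suc.hyps(1)[of "Suc k" s1] Suc.hyps(2) k 1(4) obtain t' s2 where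
      2: "exec h (While b c) s1 t' s2" "t' \<le> Suc (\<Sum>i=Suc k..<m. Suc (T i))" "I m s2"
      unfolding terminates_def by fastforce
    have "Suc (t + t') \<le> Suc (\<Sum>i=k..<m. Suc (T i))"
      using 1(3) 2(2) k by (simp add: sum.atLeast_Suc_lessThan)
    then show ?case
      using exec.WhileTrue[OF 1(1,2) 2(1)] 2(3) unfolding terminates_def by blast
  qed
  from this[of 0 s] init show ?thesis by (simp add: atLeast0LessThan)
qed

definition NEq :: "nexp \<Rightarrow> nexp \<Rightarrow> bexp" where
  "NEq d e = Conj (NLe d e) (NLe e d)"

definition Disj :: "bexp \<Rightarrow> bexp \<Rightarrow> bexp" where
  "Disj b c = Neg (Conj (Neg b) (Neg c))"

lemma bval_NEq [simp]: "bval h (NEq d e) s \<longleftrightarrow> nval d s = nval e s"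
  by (auto simp: NEq_def)

lemma bval_Disj [simp]: "bval h (Disj b c) s \<longleftrightarrow> bval h b s \<or> bval h c s"
  by (simp add: Disj_def)

abbreviation "NLess d e \<equiv> Neg (NLe e d)"

section \<open>Constructing the game\<close>

text \<open>
  Player \<open>p = a * (n * q) + i * n + u\<close> of the constructed game is slot \<open>i\<close> of player \<open>u\<close> if
  \<open>a = 0\<close>, and token \<open>i\<close> of the ordered pair \<open>(u, v)\<close> if \<open>a = Suc v\<close>.
\<close>

definition number_players :: "nat \<Rightarrow> com" where
  "number_players q =
     While (Conj (NLe (NConst 1) (Reg 0)) (NLe (Reg 1) (Reg 0)))
       (Seq (SetNTab 0 (Reg 4) (NConst 0) (Reg 1))
       (Seq (SetNTab 1 (Reg 4) (NConst 0) (Reg 2))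
       (Seq (SetNTab 2 (Reg 4) (NConst 0) (Reg 3))
       (Seq (SetReg 4 (NPlus (Reg 4) (NConst 1)))
       (Seq (SetReg 2 (NPlus (Reg 2) (NConst 1)))
         (Cond (NLe (Reg 0) (Reg 2))
            (Seq (SetReg 2 (NConst 0))
            (Seq (SetReg 3 (NPlus (Reg 3) (NConst 1)))
               (Cond (NLe (NConst q) (Reg 3))
                 (Seq (SetReg 3 (NConst 0)) (SetReg 1 (NPlus (Reg 1) (NConst 1))))
                 (SetReg 1 (Reg 1)))))
            (SetReg 1 (Reg 1))))))))"

text \<open>Lookup tables that replace division: for player \<open>p\<close>, table 0 tells the kind
  (0 for a slot, \<open>Suc v\<close> for a token with second player \<open>v\<close>), table 1 the
  owner and table 2 the copy.\<close>

definition numbered :: "nat \<Rightarrow> nat \<Rightarrow> nat \<Rightarrow> state \<Rightarrow> bool" where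
  "numbered n q k s \<longleftrightarrow>
     reg s 0 = n \<and> reg s 4 = k \<and>
     (\<forall>p<k. ntab s 0 p 0 = p div (n * q) \<and> ntab s 1 p 0 = p mod n \<and>
            ntab s 2 p 0 = p div n mod q)"

text \<open>The carry rules of a counter. The machine cannot divide, so
  \<open>number_players\<close> keeps kind, owner and copy in registers 1, 2 and 3 and advances them
  like the digits of an odometer.\<close>

lemma odometer:
  fixes k n q :: nat
  assumes "0 < n"
  shows "n \<le> Suc (k mod n) \<Longrightarrow> Suc k mod n = 0"
    and "n \<le> Suc (k mod n) \<Longrightarrow> Suc k div n = Suc (k div n)"
    and "\<not> n \<le> Suc (k mod n) \<Longrightarrow> Suc k mod n = Suc (k mod n)"
    and "\<not> n \<le> Suc (k mod n) \<Longrightarrow> Suc k div n = k div n"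
  using Suc_leI[OF mod_less_divisor[OF assms(1), of k]]
  by (auto simp: mod_Suc div_Suc)

lemma terminates_number_players:
  assumes q: "0 < q" and s: "reg s = (\<lambda>_. 0)(0 := n)"
  shows "terminates h (number_players q) s (Suc (n * q * (n + 1) * 12))
     (\<lambda>s'. numbered n q (n * q * (n + 1)) s' \<and> rtab s' = rtab s \<and> reg s' 5 = 0)"
proof -
  define I where "I k s' \<longleftrightarrow> numbered n q k s' \<and> rtab s' = rtab s \<and> reg s' 5 = 0 \<and>
     reg s' 1 = k div (n * q) \<and> reg s' 2 = k mod n \<and> reg s' 3 = k div n mod q" for k s'
  have "terminates h (number_players q) s (Suc (\<Sum>k<n * q * (n + 1). Suc 11)) (I (n * q * (n + 1)))"
    unfolding number_players_def
  proof (rule terminates_While)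
    fix k s' assume k: "k < n * q * (n + 1)" and I: "I k s'"
    then have n: "0 < n" by (cases n) auto
    have "k div (n * q) < n + 1"
      using k n q by (simp add: less_mult_imp_div_less mult.commute)
    \<comment> \<open>Dividing in two stages lets the carry rules apply twice: to \<open>k\<close>
      with base \<open>n\<close>, and to \<open>k div n\<close> with base \<open>q\<close>.\<close>
    moreover have "k div (n * q) = k div n div q" "Suc k div (n * q) = Suc k div n div q"
      by (simp_all add: div_mult2_eq)
    ultimately show "bval h (Conj (NLe (NConst 1) (Reg 0)) (NLe (Reg 1) (Reg 0))) s' \<and>
        terminates h (Seq (SetNTab 0 (Reg 4) (NConst 0) (Reg 1))
       (Seq (SetNTab 1 (Reg 4) (NConst 0) (Reg 2))
       (Seq (SetNTab 2 (Reg 4) (NConst 0) (Reg 3))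
       (Seq (SetReg 4 (NPlus (Reg 4) (NConst 1)))
       (Seq (SetReg 2 (NPlus (Reg 2) (NConst 1)))
         (Cond (NLe (Reg 0) (Reg 2))
            (Seq (SetReg 2 (NConst 0))
            (Seq (SetReg 3 (NPlus (Reg 3) (NConst 1)))
               (Cond (NLe (NConst q) (Reg 3))
                 (Seq (SetReg 3 (NConst 0)) (SetReg 1 (NPlus (Reg 1) (NConst 1))))
                 (SetReg 1 (Reg 1)))))
            (SetReg 1 (Reg 1)))))))) s' 11 (I (Suc k))"
      using I n q odometer[OF n, of k] odometer[OF q, of "k div n"]
      by (cases "n \<le> Suc (k mod n)"; cases "q \<le> Suc (k div n mod q)")
        (simp_all add: I_def numbered_def set_tab_def All_less_Suc)
  next
    fix s' assume "I (n * q * (n + 1)) s'"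
    \<comment> \<open>For \<open>n = 0\<close> it is the first conjunct that stops the loop, after
      no round at all; otherwise register 1 has reached \<open>n + 1\<close>.\<close>
    then show "\<not> bval h (Conj (NLe (NConst 1) (Reg 0)) (NLe (Reg 1) (Reg 0))) s'"
      using q by (cases "n = 0") (auto simp: I_def numbered_def)
  next
    show "I 0 s" using s by (simp add: I_def numbered_def)
  qed
  then show ?thesis
    by (rule terminates_mono) (auto simp: I_def)
qed

section \<open>The weight matrix of the constructed game\<close>

abbreviation kind :: "nat \<Rightarrow> nexp" where "kind x \<equiv> NTab 0 (Reg x) (NConst 0)"
abbreviation owner :: "nat \<Rightarrow> nexp" where "owner x \<equiv> NTab 1 (Reg x) (NConst 0)"
abbreviation copy :: "nat \<Rightarrow> nexp" where "copy x \<equiv> NTab 2 (Reg x) (NConst 0)"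
abbreviation partner :: "nat \<Rightarrow> nexp" where "partner x \<equiv> NMinus (kind x) (NConst 1)"
abbreviation enemies :: "nexp \<Rightarrow> nexp \<Rightarrow> bexp" where
  "enemies d e \<equiv> RLe (RTab 0 d e) NegInf"
abbreviation set_weight :: "rexp \<Rightarrow> com" where "set_weight \<equiv> SetRTab 1 (Reg 5) (Reg 6)"

text \<open>Register \<open>x\<close> names the slot and register \<open>y\<close> the token. Enemy
  pairs are tested first because for a concave \<open>h\<close> the difference of the two shares at
  weight \<open>-\<infinity>\<close> is infinite instead of a usable gain.\<close>

definition set_slot_token :: "nat \<Rightarrow> nat \<Rightarrow> com" where
  "set_slot_token x y =
     Cond (Conj (Neg (NEq (owner y) (partner y)))
          (Conj (Neg (enemies (owner y) (partner y)))
                (Disj (NEq (owner x) (owner y)) (NEq (owner x) (partner y)))))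
       (set_weight (RMinus (Share (NPlus (copy y) (NConst 1)) (RTab 0 (owner y) (partner y)))
                           (Share (copy y) (RTab 0 (owner y) (partner y)))))
       (set_weight (OfNat (NConst 0)))"

definition set_cell :: com where
  "set_cell =
     Cond (NEq (kind 5) (NConst 0))
       (Cond (NEq (kind 6) (NConst 0))
         (Cond (Disj (NEq (owner 5) (owner 6)) (enemies (owner 5) (owner 6)))
            (set_weight NegInf) (set_weight (OfNat (NConst 0))))
         (set_slot_token 5 6))
       (Cond (NEq (kind 6) (NConst 0))
         (set_slot_token 6 5)
         (Cond (Conj (NEq (kind 5) (kind 6)) (NEq (owner 5) (owner 6)))
            (set_weight NegInf) (set_weight (OfNat (NConst 0)))))"

definition slot_token_weight ::
    "(nat \<Rightarrow> ereal \<Rightarrow> ereal) \<Rightarrow> (nat \<Rightarrow> nat \<Rightarrow> ereal) \<Rightarrow> nat \<Rightarrow> nat \<Rightarrow> nat \<Rightarrow> nat \<Rightarrow> ereal" where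
  "slot_token_weight h W s u v i =
     (if u \<noteq> v \<and> W u v \<noteq> -\<infinity> \<and> (s = u \<or> s = v) then h (Suc i) (W u v) - h i (W u v) else 0)"

definition cell_weight ::
    "(nat \<Rightarrow> ereal \<Rightarrow> ereal) \<Rightarrow> (nat \<Rightarrow> nat \<Rightarrow> ereal) \<Rightarrow>
     nat \<Rightarrow> nat \<Rightarrow> nat \<Rightarrow> nat \<Rightarrow> nat \<Rightarrow> nat \<Rightarrow> ereal" where
  "cell_weight h W a i u b j v =
     (if a = 0 then
        (if b = 0 then (if u = v \<or> W u v = -\<infinity> then -\<infinity> else 0)
         else slot_token_weight h W u v (b - 1) j)
      else
        (if b = 0 then slot_token_weight h W v u (a - 1) i
         else (if a = b \<and> u = v then -\<infinity> else 0)))"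

definition new_weight ::
    "(nat \<Rightarrow> ereal \<Rightarrow> ereal) \<Rightarrow> nat \<Rightarrow> nat \<Rightarrow> (nat \<Rightarrow> nat \<Rightarrow> ereal) \<Rightarrow> nat \<Rightarrow> nat \<Rightarrow> ereal" where
  "new_weight h n q W p r =
     cell_weight h W (p div (n * q)) (p div n mod q) (p mod n)
                     (r div (n * q)) (r div n mod q) (r mod n)"

lemma terminates_set_slot_token:
  assumes "ntab s 0 (reg s y) 0 = Suc v" "ntab s 2 (reg s y) 0 = i" "ntab s 1 (reg s y) 0 = u"
    "ntab s 1 (reg s x) 0 = z"
    "Q (s\<lparr>rtab := set_tab (rtab s) 1 (reg s 5) (reg s 6) (slot_token_weight h (rtab s 0) z u v i)\<rparr>)"
  shows "terminates h (set_slot_token x y) s 2 Q"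
  using assms(5)
  by (auto simp: set_slot_token_def slot_token_weight_def zero_ereal_def assms(1-4)[simplified]
      split: if_splits)

text \<open>On every path at most three tests precede a single write, hence four steps.\<close>

lemma terminates_set_cell:
  assumes tabs: "ntab s 0 (reg s 5) 0 = a" "ntab s 2 (reg s 5) 0 = i" "ntab s 1 (reg s 5) 0 = u"
    "ntab s 0 (reg s 6) 0 = b" "ntab s 2 (reg s 6) 0 = j" "ntab s 1 (reg s 6) 0 = v"
    and Q: "Q (s\<lparr>rtab := set_tab (rtab s) 1 (reg s 5) (reg s 6)
      (cell_weight h (rtab s 0) a i u b j v)\<rparr>)"
  shows "terminates h set_cell s 4 Q"
proof -
  have "terminates h (set_slot_token 5 6) s 2 Q" if "a = 0" "b \<noteq> 0"
    using that Q by (intro terminates_set_slot_token) (auto simp: tabs tabs[simplified] cell_weight_def)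
  moreover have "terminates h (set_slot_token 6 5) s 2 Q" if "a \<noteq> 0" "b = 0"
    using that Q by (intro terminates_set_slot_token) (auto simp: tabs tabs[simplified] cell_weight_def)
  ultimately show ?thesis
    using Q by (auto simp: set_cell_def tabs[simplified] cell_weight_def zero_ereal_def split: if_splits)
qed

abbreviation incr_reg :: "nat \<Rightarrow> com" where
  "incr_reg x \<equiv> SetReg x (NPlus (Reg x) (NConst 1))"

definition fill_weights :: com where
  "fill_weights =
     While (NLess (Reg 5) (Reg 4))
       (Seq (SetReg 6 (NConst 0))
       (Seq (While (NLess (Reg 6) (Reg 4)) (Seq set_cell (incr_reg 6)))
            (incr_reg 5)))"

text \<open>A cell costs at most 6 steps: test, four for the cell, increment. A row adds 4: outer
  test, reset of the column, exit test of the inner loop, increment of the row. The last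
  \<open>Suc\<close> is the exit test of the outer loop.\<close>

lemma terminates_fill_weights:
  assumes s: "numbered n q N s" "reg s 5 = 0" "rtab s 0 = W"
  shows "terminates h fill_weights s (Suc (N * (6 * N + 4)))
     (\<lambda>s'. reg s' 4 = N \<and> (\<forall>p<N. \<forall>r<N. rtab s' 1 p r = new_weight h n q W p r))"
proof -
  define I where "I k s' \<longleftrightarrow> numbered n q N s' \<and> rtab s' 0 = W \<and> reg s' 5 = k \<and>
     (\<forall>p<k. \<forall>r<N. rtab s' 1 p r = new_weight h n q W p r)" for k s'
  define J where "J k m s' \<longleftrightarrow> I k s' \<and> reg s' 6 = m \<and>
     (\<forall>r<m. rtab s' 1 k r = new_weight h n q W k r)" for k m s'
  have cell: "terminates h (Seq set_cell (incr_reg 6)) s' 5 (J k (Suc m))"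
    if "k < N" "m < N" "J k m s'" for k m s'
  proof -
    have "J k (Suc m) (s'\<lparr>rtab := set_tab (rtab s') 1 k m (new_weight h n q W k m),
       reg := (reg s')(6 := Suc m)\<rparr>)"
      using that by (auto simp: J_def I_def numbered_def set_tab_def less_Suc_eq)
    then have "terminates h set_cell s' 4 (\<lambda>s1. terminates h (incr_reg 6) s1 1 (J k (Suc m)))"
      using that
      by (intro terminates_set_cell) (auto simp: J_def I_def numbered_def new_weight_def)
    from terminates_Seq[OF this] show ?thesis by simp
  qed
  have row: "terminates h (While (NLess (Reg 6) (Reg 4)) (Seq set_cell (incr_reg 6))) s'
      (Suc (\<Sum>m<N. Suc 5)) (J k N)"
    if "k < N" "J k 0 s'" for k s'
  proof (rule terminates_While)
    fix m s1 assume "m < N" "J k m s1"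
    then show "bval h (NLess (Reg 6) (Reg 4)) s1 \<and>
       terminates h (Seq set_cell (incr_reg 6)) s1 5 (J k (Suc m))"
      using cell[OF that(1)] by (auto simp: J_def I_def numbered_def)
  next
    fix s1 assume "J k N s1"
    then show "\<not> bval h (NLess (Reg 6) (Reg 4)) s1"
      by (simp add: J_def I_def numbered_def)
  qed (use that in simp)
  have body: "terminates h (Seq (SetReg 6 (NConst 0))
       (Seq (While (NLess (Reg 6) (Reg 4)) (Seq set_cell (incr_reg 6)))
            (incr_reg 5))) s' (6 * N + 3) (I (Suc k))" if "k < N" "I k s'" for k s'
  proof -
    have "J k 0 (s'\<lparr>reg := (reg s')(6 := 0)\<rparr>)"
      using that(2) by (simp add: J_def I_def numbered_def)
    from row[OF that(1) this]
    have "terminates h (While (NLess (Reg 6) (Reg 4)) (Seq set_cell (incr_reg 6)))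
      (s'\<lparr>reg := (reg s')(6 := 0)\<rparr>) (6 * N + 1)
      (\<lambda>s1. terminates h (incr_reg 5) s1 1 (I (Suc k)))"
      by (rule terminates_mono) (auto simp: J_def I_def numbered_def All_less_Suc)
    from terminates_Seq[OF this] show ?thesis by (simp add: add.commute)
  qed
  have "terminates h fill_weights s (Suc (\<Sum>k<N. Suc (6 * N + 3))) (I N)"
    unfolding fill_weights_def
  proof (rule terminates_While)
    fix k s' assume "k < N" "I k s'"
    with body[OF this] show "bval h (NLess (Reg 5) (Reg 4)) s' \<and>
       terminates h (Seq (SetReg 6 (NConst 0))
       (Seq (While (NLess (Reg 6) (Reg 4)) (Seq set_cell (incr_reg 6)))
            (incr_reg 5))) s' (6 * N + 3) (I (Suc k))"
      by (simp add: I_def numbered_def)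
  next
    fix s' assume "I N s'"
    then show "\<not> bval h (NLess (Reg 5) (Reg 4)) s'" by (simp add: I_def numbered_def)
  qed (use s in \<open>simp add: I_def\<close>)
  then show ?thesis
    by (rule terminates_mono) (auto simp: I_def numbered_def)
qed

definition construct_game :: "nat \<Rightarrow> com" where
  "construct_game q = Seq (number_players q) (Seq fill_weights (SetReg 0 (Reg 4)))"

text \<open>The work is quadratic in the number of new players, which is itself at most
  \<open>q * (n + 1) ^ 2\<close>; this explains the exponent 4.\<close>

lemma terminates_construct_game:
  assumes q: "0 < q" and s: "reg s = (\<lambda>_. 0)(0 := n)"
  shows "terminates h (construct_game q) s (40 * q ^ 2 * (n + 1) ^ 4)
     (\<lambda>s'. reg s' 0 = n * q * (n + 1) \<and>
        (\<forall>p<n * q * (n + 1). \<forall>r<n * q * (n + 1).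
           rtab s' 1 p r = new_weight h n q (rtab s 0) p r))"
    (is "terminates _ _ _ _ ?Q")
proof -
  let ?N = "n * q * (n + 1)"
  have "terminates h (number_players q) s (Suc (?N * 12))
     (\<lambda>s1. terminates h (Seq fill_weights (SetReg 0 (Reg 4))) s1 (Suc (?N * (6 * ?N + 4)) + 1) ?Q)"
    by (rule terminates_mono[OF terminates_number_players[OF q s] order_refl],
        rule terminates_Seq, rule terminates_mono[OF terminates_fill_weights order_refl])
       auto
  from terminates_Seq[OF this]
  have "terminates h (construct_game q) s (Suc (?N * 12) + (Suc (?N * (6 * ?N + 4)) + 1)) ?Q"
    unfolding construct_game_def .
  then show ?thesis
  proof (rule terminates_mono)
    have N: "?N \<le> q * (n + 1) ^ 2" by (simp add: power2_eq_square algebra_simps)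
    define M where "M = q * (n + 1) ^ 2"
    have M: "M ^ 2 = q ^ 2 * (n + 1) ^ 4"
      by (simp add: M_def power_mult_distrib flip: power_mult)
    have "1 \<le> M" using q by (simp add: M_def Suc_le_eq)
    then have "M \<le> M ^ 2" by (simp add: power2_eq_square)
    have "Suc (?N * 12) + (Suc (?N * (6 * ?N + 4)) + 1) = 16 * ?N + 6 * ?N ^ 2 + 3"
      by (simp add: power2_eq_square algebra_simps)
    also have "\<dots> \<le> 16 * M + 6 * M ^ 2 + 3"
      using N unfolding M_def by (intro add_mono mult_le_mono2 power_mono) auto
    \<comment> \<open>From \<open>1 \<le> M \<le> M ^ 2\<close> the lower-order terms are absorbed,
      as 16 + 6 + 3 is below 40.\<close>
    also have "\<dots> \<le> 40 * M ^ 2"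
      using \<open>1 \<le> M\<close> \<open>M \<le> M ^ 2\<close> by linarith
    finally show "Suc (?N * 12) + (Suc (?N * (6 * ?N + 4)) + 1) \<le> 40 * q ^ 2 * (n + 1) ^ 4"
      by (simp only: M mult.assoc)
  qed
qed

section \<open>Decoding a partition\<close>

text \<open>The machine has no multiplication; for a fixed factor, iterated addition is an
  expression of constant size.\<close>

primrec multiple :: "nat \<Rightarrow> nexp \<Rightarrow> nexp" where
  "multiple 0 e = NConst 0"
| "multiple (Suc m) e = NPlus e (multiple m e)"

lemma nval_multiple [simp]: "nval (multiple m e) s = m * nval e s"
  by (induction m) auto

definition reduce_slot :: com where
  "reduce_slot = While (NLe (Reg 0) (Reg 4)) (SetReg 4 (NMinus (Reg 4) (Reg 0)))"

text \<open>The remainder modulo \<open>n\<close> by repeated subtraction. A slot number lies below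
  \<open>n * q\<close>, so fewer than \<open>q\<close> rounds occur, a constant for fixed
  \<open>q\<close>; linear time for the decoding rests on this.\<close>

lemma terminates_reduce_slot:
  assumes s: "reg s 0 = n" "reg s 4 = p" "p < n * q"
    and Q: "Q (s\<lparr>reg := (reg s)(4 := p mod n)\<rparr>)"
  shows "terminates h reduce_slot s (2 * q + 1) Q"
proof -
  have n: "0 < n" using s(3) by (cases n) auto
  have "terminates h reduce_slot s (Suc (\<Sum>k<p div n. Suc 1))
      (\<lambda>s'. s' = s\<lparr>reg := (reg s)(4 := p - p div n * n)\<rparr>)"
    unfolding reduce_slot_def
  proof (rule terminates_While)
    fix k s' assume k: "k < p div n" and s': "s' = s\<lparr>reg := (reg s)(4 := p - k * n)\<rparr>"
    \<comment> \<open>One more multiple of \<open>n\<close> still fits into \<open>p\<close>, so the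
      test succeeds and the truncated subtraction is exact.\<close>
    have "Suc k * n \<le> p div n * n" using k by (intro mult_le_mono1) simp
    also have "\<dots> \<le> p" by simp
    finally show "bval h (NLe (Reg 0) (Reg 4)) s' \<and>
        terminates h (SetReg 4 (NMinus (Reg 4) (Reg 0))) s' 1
          (\<lambda>s'. s' = s\<lparr>reg := (reg s)(4 := p - Suc k * n)\<rparr>)"
      using s s' by (simp add: add.commute le_diff_conv2)
  next
    fix s' assume "s' = s\<lparr>reg := (reg s)(4 := p - p div n * n)\<rparr>"
    then show "\<not> bval h (NLe (Reg 0) (Reg 4)) s'"
      using s n by (simp add: not_le minus_div_mult_eq_mod)
  next
    show "s = s\<lparr>reg := (reg s)(4 := p - 0 * n)\<rparr>"
      using s by (simp add: fun_upd_idem)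
  qed
  then show ?thesis
  proof (rule terminates_mono)
    have "p div n < q" using s(3) by (simp add: less_mult_imp_div_less mult.commute)
    then show "Suc (\<Sum>k<p div n. Suc 1) \<le> 2 * q + 1" by simp
  qed (use Q in \<open>simp add: minus_div_mult_eq_mod\<close>)
qed

text \<open>Register 1 holds the group, 2 the reading position, 3 the number of owners written so
  far, and 4 the current player. Register 3 is incremented before writing because column 0 of a row
  is reserved for its length.\<close>

definition decode_group :: "nat \<Rightarrow> com" where
  "decode_group q =
     While (NLess (Reg 2) (NTab 0 (NPlus (Reg 1) (NConst 1)) (NConst 0)))
       (Seq (SetReg 4 (NTab 0 (NPlus (Reg 1) (NConst 1)) (NPlus (Reg 2) (NConst 1))))
       (Seq (incr_reg 2)
         (Cond (NLess (Reg 4) (multiple q (Reg 0)))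
           (Seq reduce_slot
           (Seq (incr_reg 3)
             (SetNTab 1 (NPlus (Reg 1) (NConst 1)) (Reg 3) (Reg 4))))
           (SetReg 4 (Reg 4)))))"

text \<open>The number of groups is copied unchanged: a group consisting of tokens only becomes an
  empty group, which a configuration may contain.\<close>

definition decode_partition :: "nat \<Rightarrow> com" where
  "decode_partition q =
     Seq (SetNTab 1 (NConst 0) (NConst 0) (NTab 0 (NConst 0) (NConst 0)))
       (While (NLess (Reg 1) (NTab 0 (NConst 0) (NConst 0)))
         (Seq (SetReg 2 (NConst 0))
         (Seq (SetReg 3 (NConst 0))
         (Seq (decode_group q)
         (Seq (SetNTab 1 (NPlus (Reg 1) (NConst 1)) (NConst 0) (Reg 3))
           (incr_reg 1))))))"

text \<open>The numbers below \<open>n * q\<close> are the slots; the filter discards the tokens,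
  and the remainder forgets the channel of a slot.\<close>

definition slot_owners :: "nat \<Rightarrow> nat \<Rightarrow> nat list \<Rightarrow> nat list" where
  "slot_owners n q xs = map (\<lambda>p. p mod n) (filter (\<lambda>p. p < n * q) xs)"

text \<open>Each member costs at most \<open>2 * q + 7\<close> steps: loop test, read, advance, slot
  test, at most \<open>2 * q + 1\<close> for the reduction, and two to append the owner.\<close>

lemma terminates_decode_group:
  fixes n q :: nat and s :: state
  assumes s: "reg s 0 = n" "reg s 1 = l" "reg s 2 = 0" "reg s 3 = 0"
    and xs: "ntab s 0 (Suc l) 0 = length xs" "\<And>j. j < length xs \<Longrightarrow> ntab s 0 (Suc l) (Suc j) = xs ! j"
  shows "terminates h (decode_group q) s (Suc (length xs * (2 * q + 7)))
     (\<lambda>s'. reg s' 0 = n \<and> reg s' 1 = l \<and> ntab s' 0 = ntab s 0 \<and>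
        (\<forall>i. i \<noteq> Suc l \<longrightarrow> ntab s' 1 i = ntab s 1 i) \<and>
        reg s' 3 = length (slot_owners n q xs) \<and>
        (\<forall>j<length (slot_owners n q xs). ntab s' 1 (Suc l) (Suc j) = slot_owners n q xs ! j))"
proof -
  define I where "I k s' \<longleftrightarrow> reg s' 0 = n \<and> reg s' 1 = l \<and> ntab s' 0 = ntab s 0 \<and>
        (\<forall>i. i \<noteq> Suc l \<longrightarrow> ntab s' 1 i = ntab s 1 i) \<and> reg s' 2 = k \<and>
        reg s' 3 = length (slot_owners n q (take k xs)) \<and>
        (\<forall>j<length (slot_owners n q (take k xs)).
            ntab s' 1 (Suc l) (Suc j) = slot_owners n q (take k xs) ! j)" for k and s' :: state
  have "terminates h (decode_group q) s (Suc (\<Sum>k<length xs. Suc (2 * q + 6))) (I (length xs))"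
    unfolding decode_group_def
  proof (rule terminates_While)
    fix k s' assume k: "k < length xs" and I: "I k s'"
    let ?ys = "slot_owners n q (take k xs)"
    have ys: "slot_owners n q (take (Suc k) xs) =
        (if xs ! k < n * q then ?ys @ [xs ! k mod n] else ?ys)"
      using k by (simp add: slot_owners_def take_Suc_conv_app_nth)
    define s1 where "s1 = s'\<lparr>reg := (reg s')(4 := xs ! k, 2 := Suc k)\<rparr>"
    have push: "terminates h (Seq reduce_slot
           (Seq (incr_reg 3)
             (SetNTab 1 (NPlus (Reg 1) (NConst 1)) (Reg 3) (Reg 4)))) s1
         (2 * q + 1 + 2) (I (Suc k))" if "xs ! k < n * q"
      using that I ys
      by (intro terminates_Seq terminates_reduce_slot[where n = n and p = "xs ! k"])
        (auto simp: s1_def I_def set_tab_def nth_append less_Suc_eq)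
    have "terminates h (Cond (NLess (Reg 4) (multiple q (Reg 0)))
           (Seq reduce_slot
           (Seq (incr_reg 3)
             (SetNTab 1 (NPlus (Reg 1) (NConst 1)) (Reg 3) (Reg 4))))
           (SetReg 4 (Reg 4))) s1 (4 + 2 * q) (I (Suc k))"
    proof (cases "xs ! k < n * q")
      case True
      then show ?thesis
        using terminates_mono[OF push[OF True], of "4 + 2 * q - 1" "I (Suc k)"] I
        by (simp add: I_def s1_def mult.commute)
    next
      case False
      then show ?thesis
        using I ys by (simp add: s1_def I_def mult.commute)
    qed
    then show "bval h (NLess (Reg 2) (NTab 0 (NPlus (Reg 1) (NConst 1)) (NConst 0))) s' \<and>
       terminates h (Seq (SetReg 4 (NTab 0 (NPlus (Reg 1) (NConst 1)) (NPlus (Reg 2) (NConst 1))))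
       (Seq (incr_reg 2)
         (Cond (NLess (Reg 4) (multiple q (Reg 0)))
           (Seq reduce_slot
           (Seq (incr_reg 3)
             (SetNTab 1 (NPlus (Reg 1) (NConst 1)) (Reg 3) (Reg 4))))
           (SetReg 4 (Reg 4))))) s' (2 * q + 6) (I (Suc k))"
      using I k xs by (simp del: terminates_Cond add: I_def s1_def)
  next
    fix s' assume "I (length xs) s'"
    then show "\<not> bval h (NLess (Reg 2) (NTab 0 (NPlus (Reg 1) (NConst 1)) (NConst 0))) s'"
      using xs by (simp add: I_def)
  qed (use s in \<open>simp add: I_def slot_owners_def\<close>)
  then show ?thesis
    by (rule terminates_mono) (auto simp: I_def)
qed

text \<open>Besides its members, a group costs 6 steps: loop test, two resets, exit test of the
  inner loop, writing the length, increment.\<close>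

lemma terminates_decode_partition:
  fixes n q :: nat and xss :: "nat list list"
  shows "terminates h (decode_partition q) (partition_input n xss)
     (Suc (Suc (\<Sum>xs\<leftarrow>xss. 6 + length xs * (2 * q + 7))))
     (\<lambda>s'. output_groups s' = map (slot_owners n q) xss)"
proof -
  let ?s = "partition_input n xss"
  let ?T = "ntab ?s 0"
  let ?L = "length xss"
  define row where "row l s' \<longleftrightarrow> ntab s' 1 (Suc l) 0 = length (slot_owners n q (xss ! l)) \<and>
     (\<forall>j<length (slot_owners n q (xss ! l)).
        ntab s' 1 (Suc l) (Suc j) = slot_owners n q (xss ! l) ! j)" for l and s' :: state
  define I where "I k s' \<longleftrightarrow> reg s' 0 = n \<and> reg s' 1 = k \<and> ntab s' 0 = ?T \<and>
     ntab s' 1 0 0 = ?L \<and> (\<forall>l<k. row l s')" for k and s' :: state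
  have T0: "?T 0 0 = ?L"
    by (simp add: partition_input_def blank_state_def table_of_lists_def nth_default_def)
  have T1: "?T (Suc l) 0 = length (xss ! l)" if "l < ?L" for l
    using that
    by (simp add: partition_input_def blank_state_def table_of_lists_def nth_default_def)
  have T2: "?T (Suc l) (Suc j) = xss ! l ! j" if "l < ?L" "j < length (xss ! l)" for l j
    using that
    by (simp add: partition_input_def blank_state_def table_of_lists_def nth_default_def)
  let ?body = "Seq (SetReg 2 (NConst 0))
         (Seq (SetReg 3 (NConst 0))
         (Seq (decode_group q)
         (Seq (SetNTab 1 (NPlus (Reg 1) (NConst 1)) (NConst 0) (Reg 3))
           (incr_reg 1))))"
  let ?loop = "While (NLess (Reg 1) (NTab 0 (NConst 0) (NConst 0))) ?body"
  define s0 where "s0 = ?s\<lparr>ntab := set_tab (ntab ?s) 1 0 0 ?L\<rparr>"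
  have "terminates h ?loop s0 (Suc (\<Sum>k<?L. Suc (length (xss ! k) * (2 * q + 7) + 5))) (I ?L)"
  proof (rule terminates_While)
    fix k s' assume k: "k < ?L" and I: "I k s'"
    define s1 where "s1 = s'\<lparr>reg := (reg s')(2 := 0, 3 := 0)\<rparr>"
    have "terminates h (decode_group q) s1 (Suc (length (xss ! k) * (2 * q + 7)))
       (\<lambda>s2. terminates h (Seq (SetNTab 1 (NPlus (Reg 1) (NConst 1)) (NConst 0) (Reg 3))
           (incr_reg 1)) s2 2 (I (Suc k)))"
      by (rule terminates_mono[OF terminates_decode_group order_refl])
        (use I k T1[OF k] T2[OF k] in
          \<open>auto simp: s1_def I_def row_def set_tab_def less_Suc_eq\<close>)
    from terminates_Seq[OF this]
    have "terminates h (Seq (decode_group q)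
        (Seq (SetNTab 1 (NPlus (Reg 1) (NConst 1)) (NConst 0) (Reg 3)) (incr_reg 1))) s1
        (3 + length (xss ! k) * (2 * q + 7)) (I (Suc k))"
      by (rule terminates_mono) auto
    then show "bval h (NLess (Reg 1) (NTab 0 (NConst 0) (NConst 0))) s' \<and>
        terminates h ?body s' (length (xss ! k) * (2 * q + 7) + 5) (I (Suc k))"
      using I k T0 by (simp add: s1_def I_def)
  next
    fix s' assume "I ?L s'"
    then show "\<not> bval h (NLess (Reg 1) (NTab 0 (NConst 0) (NConst 0))) s'"
      using T0 by (simp add: I_def)
  next
    show "I 0 s0"
      by (auto simp: s0_def I_def set_tab_def partition_input_def)
  qed
  then have "terminates h (decode_partition q) ?s
      (Suc (Suc (\<Sum>k<?L. 6 + length (xss ! k) * (2 * q + 7)))) (I ?L)"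
    using T0 by (simp add: decode_partition_def s0_def)
  moreover have "(\<Sum>k<?L. 6 + length (xss ! k) * (2 * q + 7)) =
      (\<Sum>xs\<leftarrow>xss. 6 + length xs * (2 * q + 7))"
    by (simp add: sum_list_sum_nth atLeast0LessThan)
  moreover have "output_groups s' = map (slot_owners n q) xss" if "I ?L s'" for s'
    unfolding output_groups_def lists_of_table_def
    by (rule nth_equalityI) (use that in \<open>auto simp: I_def row_def intro!: nth_equalityI\<close>)
  ultimately show ?thesis
    by (auto intro: terminates_mono)
qed


section \<open>Concave sharing functions and fibres\<close>

text \<open>A real-valued version of \<open>increment\<close>, with which it agrees at finite
  weights in \<open>nat_weights\<close>; sums over gains can then be handled in the reals.\<close>

definition gain :: "(nat \<Rightarrow> ereal \<Rightarrow> ereal) \<Rightarrow> ereal \<Rightarrow> nat \<Rightarrow> real" where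
  "gain h x k = real_of_ereal (h (Suc k) x) - real_of_ereal (h k x)"

lemma nat_weightsE:
  assumes "x \<in> nat_weights" "x \<noteq> -\<infinity>"
  obtains m :: nat where "x = ereal (real m)"
  using assms by (auto simp: nat_weights_def)

lemma nat_weights_subset_int_weights: "nat_weights \<subseteq> int_weights"
  unfolding nat_weights_def int_weights_def
  by (auto simp: image_iff) (metis of_int_of_nat_eq)

text \<open>The first increment is \<open>-\<infinity>\<close> because \<open>h 1\<close> is the
  identity on weights, so by concavity all later ones are. Leaving \<open>-\<infinity>\<close> again
  would be an increment of \<open>\<infinity>\<close>.\<close>

lemma share_enemies:
  assumes "sharing_function h" "concave_sharing h" "g \<ge> 1"
  shows "h g (-\<infinity>) = -\<infinity>"
proof -
  have int: "-\<infinity> \<in> int_weights" by (simp add: int_weights_def)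
  have h1: "h (Suc 0) (-\<infinity>) = -\<infinity>"
    using assms(1) int unfolding sharing_function_def by (metis One_nat_def)
  have "h (Suc g) (-\<infinity>) = -\<infinity>" for g
  proof (induction g)
    case 0
    show ?case using h1 .
  next
    case (Suc g)
    have "antimono (increment h (-\<infinity>))"
      using assms(2) int by (simp add: concave_sharing_def)
    then have "increment h (-\<infinity>) (Suc g) \<le> increment h (-\<infinity>) 0"
      by (rule antimonoD) simp
    also have "\<dots> = -\<infinity>" using h1 by (simp add: increment_def)
    finally show ?case using Suc by (auto simp: increment_def split: if_splits)
  qed
  then show ?thesis using assms(3) by (cases g) auto
qed

context
  fixes h :: "nat \<Rightarrow> ereal \<Rightarrow> ereal" and x :: ereal
  assumes h: "sharing_function h" "concave_sharing h"
    and x: "x \<in> nat_weights" "x \<noteq> -\<infinity>"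
begin

lemma share_nonneg: "0 \<le> h g x"
proof -
  have "h g 0 \<le> h g x"
  proof (rule mono_onD[of int_weights "h g"])
    show "mono_on int_weights (h g)" using h(1) by (simp add: sharing_function_def)
    have "0 \<in> nat_weights" by (auto simp: nat_weights_def zero_ereal_def intro!: rev_image_eqI[of 0])
    then show "0 \<in> int_weights" "x \<in> int_weights"
      using x(1) nat_weights_subset_int_weights by auto
    show "0 \<le> x" using x by (auto elim!: nat_weightsE)
  qed
  then show ?thesis using h(1) by (simp add: sharing_function_def)
qed

lemma share_finite: "\<bar>h g x\<bar> \<noteq> \<infinity>"
  using share_nonneg[of g] h(1) x nat_weights_subset_int_weights
  by (auto simp: sharing_function_def)

lemma ereal_gain: "ereal (gain h x k) = h (Suc k) x - h k x"
  using share_finite by (simp add: gain_def ereal_real flip: ereal_minus(1))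

text \<open>For a positive weight, monotonicity of \<open>x * h g x\<close> in \<open>g\<close> can
  be divided by \<open>x\<close>; at weight 0 every share vanishes.\<close>

lemma gain_nonneg: "0 \<le> gain h x k"
proof -
  obtain m where m: "x = ereal (real m)" using x by (rule nat_weightsE)
  show ?thesis
  proof (cases "m = 0")
    case True
    then show ?thesis
      using h(1) m by (simp add: gain_def sharing_function_def zero_ereal_def[symmetric])
  next
    case False
    have "mono (\<lambda>g. x * h g x)"
      using h(1) x nat_weights_subset_int_weights by (auto simp: sharing_function_def)
    then have "x * h k x \<le> x * h (Suc k) x" by (rule monoD) simp
    then have "h k x \<le> h (Suc k) x"
      using False by (simp add: m ereal_mult_le_mult_iff)
    then show ?thesis
      using share_finite[of k] share_finite[of "Suc k"]
      by (simp add: gain_def real_of_ereal_positive_mono share_nonneg)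
  qed
qed

lemma gain_antimono: "antimono (gain h x)"
proof -
  have "increment h x k = ereal (gain h x k)" for k
    using share_finite[of "Suc k"] by (auto simp: increment_def ereal_gain)
  moreover have "antimono (increment h x)"
    using h(2) x nat_weights_subset_int_weights by (auto simp: concave_sharing_def)
  ultimately show ?thesis by (simp add: antimono_def)
qed

lemma share_eq_sum_gain: "h g x = ereal (\<Sum>k<g. gain h x k)"
proof -
  have "h 0 x = 0"
    using h(1) x nat_weights_subset_int_weights by (auto simp: sharing_function_def)
  then have "(\<Sum>k<g. gain h x k) = real_of_ereal (h g x)"
    unfolding gain_def by (subst sum_lessThan_telescope) simp
  then show ?thesis using share_finite by (simp add: ereal_real)
qed

end

text \<open>Among index sets of a given size, an initial segment maximizes the sum of a
  non-increasing sequence: the largest element of \<open>K\<close> is at least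
  \<open>card K - 1\<close>, so its term is at most the last term of the segment. Remove it and
  induct.\<close>

lemma sum_antimono_le:
  fixes f :: "nat \<Rightarrow> real"
  assumes "finite K" "antimono f"
  shows "(\<Sum>k\<in>K. f k) \<le> (\<Sum>k<card K. f k)"
  using assms(1)
proof (induction "card K" arbitrary: K)
  case 0
  then show ?case by simp
next
  case (Suc n)
  then have K: "K \<noteq> {}" by auto
  define m where "m = Max K"
  have m: "m \<in> K" using K Suc.prems by (simp add: m_def)
  have "K \<subseteq> {..m}" using Suc.prems by (auto simp: m_def)
  then have "card K \<le> Suc m" by (metis card_atMost card_mono finite_atMost)
  then have "f m \<le> f n" using Suc.hyps(2) assms(2) by (simp add: antimono_def)
  moreover have "(\<Sum>k\<in>K - {m}. f k) \<le> (\<Sum>k<n. f k)"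
    using Suc.hyps(1)[of "K - {m}"] Suc.prems m
    by (simp flip: Suc.hyps(2))
  moreover have "(\<Sum>k\<in>K. f k) = f m + (\<Sum>k\<in>K - {m}. f k)"
    using Suc.prems m by (rule sum.remove)
  ultimately show ?case using Suc.hyps(2)[symmetric] by simp
qed

text \<open>List \<open>B\<close> first and the rest of \<open>A\<close> afterwards. This will order
  the groups of a player so that those shared with a given other player come first.\<close>

lemma enumeration_prefix:
  assumes "finite A" "B \<subseteq> A"
  obtains e :: "nat \<Rightarrow> 'a" where "bij_betw e {..<card A} A" "\<And>k. k < card B \<Longrightarrow> e k \<in> B"
proof -
  have fin: "finite B" "finite (A - B)" using assms by (auto intro: finite_subset)
  obtain xs where xs: "set xs = B" "distinct xs" using finite_distinct_list[OF fin(1)] by auto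
  obtain ys where ys: "set ys = A - B" "distinct ys" using finite_distinct_list[OF fin(2)] by auto
  have "length (xs @ ys) = card A"
    using xs ys assms by (metis Diff_disjoint Un_Diff_cancel distinct_append distinct_card
        set_append sup.absorb2)
  then have "bij_betw ((!) (xs @ ys)) {..<card A} A"
    using xs ys assms(2) by (intro bij_betw_nth) auto
  moreover have "(xs @ ys) ! k \<in> B" if "k < card B" for k
    using that xs by (metis distinct_card nth_append nth_mem)
  ultimately show thesis by (rule that)
qed

section \<open>Finite sums of extended reals\<close>

lemma ereal_sum_finite:
  fixes f :: "'b \<Rightarrow> ereal"
  assumes "\<And>i. i \<in> A \<Longrightarrow> \<bar>f i\<bar> \<noteq> \<infinity>"
  shows "(\<Sum>i\<in>A. f i) = ereal (\<Sum>i\<in>A. real_of_ereal (f i))"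
  using assms by (simp add: ereal_real flip: sum_ereal)

lemma ereal_sum_neq_PInf:
  fixes f :: "'b \<Rightarrow> ereal"
  assumes "\<And>i. i \<in> A \<Longrightarrow> f i \<noteq> \<infinity>"
  shows "(\<Sum>i\<in>A. f i) \<noteq> \<infinity>"
  using assms by (auto simp: sum_Pinfty)

text \<open>Excluding \<open>\<infinity>\<close> matters, since a summand \<open>\<infinity>\<close>
  would outweigh \<open>-\<infinity>\<close>.\<close>

lemma ereal_sum_eq_MInf:
  fixes f :: "'b \<Rightarrow> ereal"
  assumes "finite A" "\<And>i. i \<in> A \<Longrightarrow> f i \<noteq> \<infinity>" "i \<in> A" "f i = -\<infinity>"
  shows "(\<Sum>i\<in>A. f i) = -\<infinity>"
proof -
  have "(\<Sum>i\<in>A. f i) = f i + (\<Sum>i\<in>A - {i}. f i)"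
    using assms by (intro sum.remove)
  then show ?thesis
    using assms(4) ereal_sum_neq_PInf[of "A - {i}" f] assms(2) by simp
qed

section \<open>Groups of a partition and partitions into fibres\<close>

lemma group_of_eq:
  assumes "partition_on A P" "X \<in> P" "p \<in> X"
  shows "group_of P p = X"
  unfolding group_of_def
proof (rule the_equality)
  fix Y assume "Y \<in> P \<and> p \<in> Y"
  then show "Y = X"
    using assms partition_onD2[OF assms(1)] by (auto simp: disjoint_def)
qed (use assms in simp)

lemma group_of_mem:
  assumes "partition_on A P" "p \<in> A"
  shows "group_of P p \<in> P" "p \<in> group_of P p"
proof -
  obtain X where "X \<in> P" "p \<in> X"
    using assms by (auto simp: partition_on_def)
  then show "group_of P p \<in> P" "p \<in> group_of P p"
    using group_of_eq[OF assms(1)] by auto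
qed

text \<open>Partitions are produced by labelling players: \<open>id\<close> gives the singletons,
  and labels naming groups of a configuration give the partition that attains the bound.\<close>

definition fibres :: "('a \<Rightarrow> 'b) \<Rightarrow> 'a set \<Rightarrow> 'a set set" where
  "fibres f A = (\<lambda>p. {r \<in> A. f r = f p}) ` A"

lemma partition_on_fibres: "partition_on A (fibres f A)"
  unfolding fibres_def by (rule partition_onI) (auto simp: disjnt_def)

lemma group_of_fibres: "p \<in> A \<Longrightarrow> group_of (fibres f A) p = {r \<in> A. f r = f p}"
  by (rule group_of_eq[OF partition_on_fibres]) (auto simp: fibres_def)


section \<open>Slots and tokens\<close>

definition token_gain :: "(nat \<Rightarrow> ereal \<Rightarrow> ereal) \<Rightarrow> ('a \<Rightarrow> 'a \<Rightarrow> ereal) \<Rightarrow> 'a \<Rightarrow> 'a \<Rightarrow> nat \<Rightarrow> real" where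
  "token_gain h w u v k = (if u \<noteq> v \<and> w u v \<noteq> -\<infinity> then gain h (w u v) k else 0)"

text \<open>The constructed game up to the names of its players, so that the combinatorial argument
  is independent of the numbering used by the program. Pairs \<open>(u, u)\<close> have tokens too,
  of gain 0, which keeps the indexing a full product.\<close>

locale slot_token_game =
  fixes q :: nat and h :: "nat \<Rightarrow> ereal \<Rightarrow> ereal" and V :: "'a set" and w :: "'a \<Rightarrow> 'a \<Rightarrow> ereal"
    and slot :: "'a \<times> nat \<Rightarrow> 'b" and token :: "('a \<times> 'a) \<times> nat \<Rightarrow> 'b"
    and V' :: "'b set" and w' :: "'b \<Rightarrow> 'b \<Rightarrow> ereal"
  assumes h: "sharing_function h" "concave_sharing h"
    and game: "coloring_game V w" "weights_in nat_weights V w"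
    and V': "V' = slot ` (V \<times> {..<q}) \<union> token ` ((V \<times> V) \<times> {..<q})"
    and inj_slot: "inj_on slot (V \<times> {..<q})"
    and inj_token: "inj_on token ((V \<times> V) \<times> {..<q})"
    and disj: "slot ` (V \<times> {..<q}) \<inter> token ` ((V \<times> V) \<times> {..<q}) = {}"
    and slot_slot: "\<And>u v i j. \<lbrakk>u \<in> V; v \<in> V; i < q; j < q; slot (u, i) \<noteq> slot (v, j)\<rbrakk> \<Longrightarrow>
      w' (slot (u, i)) (slot (v, j)) = (if u = v \<or> w u v = -\<infinity> then -\<infinity> else 0)"
    and slot_token: "\<And>s i e k. \<lbrakk>s \<in> V; i < q; e \<in> V \<times> V; k < q\<rbrakk> \<Longrightarrow>
      w' (slot (s, i)) (token (e, k)) =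
        ereal (if s = fst e \<or> s = snd e then token_gain h w (fst e) (snd e) k else 0)"
    and token_slot: "\<And>s i e k. \<lbrakk>s \<in> V; i < q; e \<in> V \<times> V; k < q\<rbrakk> \<Longrightarrow>
      w' (token (e, k)) (slot (s, i)) = w' (slot (s, i)) (token (e, k))"
    and token_token: "\<And>e e' k k'. \<lbrakk>e \<in> V \<times> V; e' \<in> V \<times> V; k < q; k' < q; token (e, k) \<noteq> token (e', k')\<rbrakk> \<Longrightarrow>
      w' (token (e, k)) (token (e', k')) = (if e = e' then -\<infinity> else 0)"
begin

definition feasible :: "'b set set \<Rightarrow> bool" where
  "feasible P \<longleftrightarrow> partition_on V' P \<and>
     (\<forall>X\<in>P. \<forall>p\<in>X. \<forall>r\<in>X. p \<noteq> r \<longrightarrow> w' p r \<noteq> -\<infinity>)"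

definition meetings :: "'b set set \<Rightarrow> 'a \<Rightarrow> 'b \<Rightarrow> nat" where
  "meetings P s t = card {i. i < q \<and> slot (s, i) \<in> group_of P t}"

definition slot_set :: "'b set" where "slot_set = slot ` (V \<times> {..<q})"
definition token_set :: "'b set" where "token_set = token ` ((V \<times> V) \<times> {..<q})"

definition members :: "'b set \<Rightarrow> 'a set" where
  "members X = {u \<in> V. \<exists>i<q. slot (u, i) \<in> X}"

text \<open>A multiset image, since distinct groups may project to the same set of players, possibly
  the empty one.\<close>

definition config_of :: "'b set set \<Rightarrow> 'a set multiset" where
  "config_of P = image_mset members (mset_set P)"

abbreviation share_sum :: "'a \<Rightarrow> 'a \<Rightarrow> nat \<Rightarrow> real" where
  "share_sum u v g \<equiv> (\<Sum>k<g. token_gain h w u v k)"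

text \<open>With the sharing counts of a configuration that separates enemies, this is its utility.
  With the constant count \<open>q\<close>, it is the amount the tokens earn by each meeting one
  slot.\<close>

definition total :: "('a \<Rightarrow> 'a \<Rightarrow> nat) \<Rightarrow> real" where
  "total g = (\<Sum>u\<in>V. \<Sum>v\<in>V. share_sum u v (g u v))"

lemma finite_V: "finite V" using game(1) by (simp add: coloring_game_def)

lemma finite_V': "finite V'" using finite_V by (simp add: V')

lemma V'_eq: "V' = slot_set \<union> token_set" "slot_set \<inter> token_set = {}"
  using V' disj by (auto simp: slot_set_def token_set_def)

lemma weight_nat: "u \<in> V \<Longrightarrow> v \<in> V \<Longrightarrow> u \<noteq> v \<Longrightarrow> w u v \<in> nat_weights"
  using game(2) by (simp add: weights_in_def)

lemma token_gain_nonneg: "u \<in> V \<Longrightarrow> v \<in> V \<Longrightarrow> 0 \<le> token_gain h w u v k"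
  using gain_nonneg[OF h] weight_nat by (auto simp: token_gain_def)

lemma token_gain_antimono: "u \<in> V \<Longrightarrow> v \<in> V \<Longrightarrow> antimono (token_gain h w u v)"
  using gain_antimono[OF h weight_nat, of u v] by (auto simp: token_gain_def antimono_def)

lemma share_eq:
  assumes "u \<in> V" "v \<in> V" "u \<noteq> v" "w u v = -\<infinity> \<Longrightarrow> g = 0"
  shows "h g (w u v) = ereal (share_sum u v g)"
proof (cases "w u v = -\<infinity>")
  case True
  then show ?thesis
    using assms(4) h(1) by (simp add: sharing_function_def int_weights_def zero_ereal_def)
next
  case False
  then show ?thesis
    using share_eq_sum_gain[OF h weight_nat[OF assms(1-3)]] assms(3) by (simp add: token_gain_def)
qed

lemma new_game: "coloring_game V' w'"
proof -
  have "w u v = w v u" if "u \<in> V" "v \<in> V" "u \<noteq> v" for u v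
    using that game(1) by (auto simp: coloring_game_def)
  note sym = this
  have "w' p r = w' r p \<and> w' p r \<noteq> \<infinity>" if "p \<in> V'" "r \<in> V'" "p \<noteq> r" for p r
    using that unfolding V'
    by (elim UnE imageE; auto simp: slot_slot slot_token token_slot token_token split: if_splits;
        metis sym)
  then show ?thesis using finite_V' by (simp add: coloring_game_def)
qed

lemma weight_not_PInf: "p \<in> V' \<Longrightarrow> r \<in> V' \<Longrightarrow> p \<noteq> r \<Longrightarrow> w' p r \<noteq> \<infinity>"
  using new_game by (simp add: coloring_game_def)

section \<open>Feasible partitions and their utility\<close>

lemma group_subset:
  assumes "partition_on V' P" "p \<in> V'"
  shows "group_of P p \<subseteq> V'" "finite (group_of P p)"
proof -
  show "group_of P p \<subseteq> V'"
    using group_of_mem[OF assms] assms(1) by (auto simp: partition_on_def)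
  then show "finite (group_of P p)" using finite_V' finite_subset by blast
qed

lemma group_of_sym:
  assumes "partition_on V' P" "p \<in> V'" "r \<in> group_of P p"
  shows "p \<in> group_of P r"
  using group_of_eq[OF assms(1) group_of_mem(1)[OF assms(1,2)] assms(3)]
    group_of_mem(2)[OF assms(1,2)] by simp

text \<open>A single pair of enemies in a group makes the whole sum \<open>-\<infinity>\<close>,
  because no weight \<open>\<infinity>\<close> occurs that could mask it.\<close>

lemma feasible_if_utility:
  assumes P: "partition_on V' P" and f: "global_partition_utility V' w' P \<noteq> -\<infinity>"
  shows "feasible P"
proof (rule ccontr)
  assume "\<not> feasible P"
  then obtain X p r where X: "X \<in> P" "p \<in> X" "r \<in> X" "p \<noteq> r" "w' p r = -\<infinity>"
    using P by (auto simp: feasible_def)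
  have p: "p \<in> V'" using X P by (auto simp: partition_on_def)
  have no_inf: "partition_utility w' P t \<noteq> \<infinity>" if "t \<in> V'" for t
    unfolding partition_utility_def
    using group_subset[OF P that] that weight_not_PInf by (intro ereal_sum_neq_PInf) auto
  have "partition_utility w' P p = -\<infinity>"
    unfolding partition_utility_def
    using group_subset[OF P p] p weight_not_PInf X group_of_eq[OF P X(1,2)]
    by (intro ereal_sum_eq_MInf[where i = r]) auto
  then have "global_partition_utility V' w' P = -\<infinity>"
    unfolding global_partition_utility_def
    using p no_inf finite_V' by (intro ereal_sum_eq_MInf)
  with f show False by simp
qed

text \<open>In a feasible partition, slot-slot and token-token pairs contribute nothing. Slot-token
  pairs are counted from both sides, whence the factor 2.\<close>

lemma utility_eq:
  assumes P: "feasible P"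
  shows "global_partition_utility V' w' P =
    ereal (2 * (\<Sum>(e, k)\<in>(V \<times> V) \<times> {..<q}. token_gain h w (fst e) (snd e) k *
      (real (meetings P (fst e) (token (e, k))) + real (meetings P (snd e) (token (e, k))))))"
proof -
  have part: "partition_on V' P" using P by (simp add: feasible_def)
  have fin: "\<bar>w' p r\<bar> \<noteq> \<infinity>" if "p \<in> V'" "r \<in> group_of P p - {p}" for p r
    using that P group_of_mem[OF part that(1)] group_subset[OF part that(1)] weight_not_PInf[of p r]
    by (auto simp: feasible_def)
  \<comment> \<open>Weights extended by 0 outside the group, so that all sums range over the fixed
    set \<open>V'\<close>.\<close>
  define val where "val p r = (if r \<in> group_of P p \<and> r \<noteq> p then real_of_ereal (w' p r) else 0)" for p r
  have "partition_utility w' P p = ereal (\<Sum>r\<in>V'. val p r)" if p: "p \<in> V'" for p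
  proof -
    have "partition_utility w' P p = ereal (\<Sum>r\<in>group_of P p - {p}. real_of_ereal (w' p r))"
      unfolding partition_utility_def by (rule ereal_sum_finite) (use fin p in auto)
    also have "(\<Sum>r\<in>group_of P p - {p}. real_of_ereal (w' p r)) = (\<Sum>r\<in>V'. val p r)"
      using group_subset[OF part p] finite_V'
      by (intro sum.mono_neutral_cong_left) (auto simp: val_def)
    finally show ?thesis .
  qed
  then have f: "global_partition_utility V' w' P = ereal (\<Sum>p\<in>V'. \<Sum>r\<in>V'. val p r)"
    by (simp add: global_partition_utility_def)
  have sym: "val p r = val r p" if "p \<in> V'" "r \<in> V'" for p r
    using that group_of_sym[OF part] new_game unfolding val_def coloring_game_def by metis
  have ss: "val p r = 0" if "p \<in> slot_set" "r \<in> slot_set" for p r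
    using that by (auto simp: val_def slot_set_def slot_slot)
  have tt: "val p r = 0" if "p \<in> token_set" "r \<in> token_set" for p r
    using that by (auto simp: val_def token_set_def token_token)
  have split: "(\<Sum>r\<in>V'. f r) = (\<Sum>r\<in>slot_set. f r) + (\<Sum>r\<in>token_set. f r)" for f :: "'b \<Rightarrow> real"
    using finite_V' V'_eq by (metis finite_Un sum.union_disjoint)
  have "(\<Sum>p\<in>V'. \<Sum>r\<in>V'. val p r) =
      (\<Sum>p\<in>slot_set. \<Sum>r\<in>token_set. val p r) + (\<Sum>p\<in>token_set. \<Sum>r\<in>slot_set. val p r)"
    by (simp add: split ss tt)
  also have "(\<Sum>p\<in>slot_set. \<Sum>r\<in>token_set. val p r) = (\<Sum>p\<in>token_set. \<Sum>r\<in>slot_set. val p r)"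
    by (subst sum.swap) (intro sum.cong refl sym, use V'_eq in auto)
  finally have f2: "(\<Sum>p\<in>V'. \<Sum>r\<in>V'. val p r) = 2 * (\<Sum>p\<in>token_set. \<Sum>r\<in>slot_set. val p r)"
    by simp
  have row: "(\<Sum>r\<in>slot_set. val (token (e, k)) r) = token_gain h w (fst e) (snd e) k *
      (real (meetings P (fst e) (token (e, k))) + real (meetings P (snd e) (token (e, k))))"
    if e: "e \<in> V \<times> V" "k < q" for e k
  proof -
    let ?t = "token (e, k)" and ?d = "token_gain h w (fst e) (snd e) k"
    have "slot (s, i) \<noteq> ?t" if "s \<in> V" "i < q" for s i
    proof -
      have "slot (s, i) \<in> slot_set" "?t \<in> token_set"
        using that e by (auto simp: slot_set_def token_set_def)
      then show ?thesis using V'_eq(2) by auto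
    qed
    then have v: "val ?t (slot (s, i)) =
        (if slot (s, i) \<in> group_of P ?t then (if s = fst e \<or> s = snd e then ?d else 0) else 0)"
      if "s \<in> V" "i < q" for s i
      using that e by (simp add: val_def token_slot slot_token)
    have "(\<Sum>r\<in>slot_set. val ?t r) = (\<Sum>(s, i)\<in>V \<times> {..<q}. val ?t (slot (s, i)))"
      unfolding slot_set_def by (subst sum.reindex[OF inj_slot]) (simp add: case_prod_unfold)
    also have "\<dots> = (\<Sum>s\<in>V. \<Sum>i<q. val ?t (slot (s, i)))"
      by (rule sum.cartesian_product[symmetric])
    also have "\<dots> = (\<Sum>s\<in>V. (if s = fst e \<or> s = snd e then ?d else 0) * real (meetings P s ?t))"
    proof (rule sum.cong[OF refl])
      fix s assume s: "s \<in> V"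
      have "(\<Sum>i<q. val ?t (slot (s, i))) =
          (\<Sum>i\<in>{i. i < q \<and> slot (s, i) \<in> group_of P ?t}. (if s = fst e \<or> s = snd e then ?d else 0))"
        by (rule sum.mono_neutral_cong_right) (use s v in auto)
      then show "(\<Sum>i<q. val ?t (slot (s, i))) =
          (if s = fst e \<or> s = snd e then ?d else 0) * real (meetings P s ?t)"
        by (simp add: meetings_def)
    qed
    also have "\<dots> = ?d * (real (meetings P (fst e) ?t) + real (meetings P (snd e) ?t))"
    \<comment> \<open>For a pair of equal players the disjunction selects one player while the
      right-hand side counts it twice; both sides vanish because the gain is 0.\<close>
    proof (cases "fst e = snd e")
      case True
      then have "?d = 0" by (simp add: token_gain_def)
      then show ?thesis by (simp cong: if_cong)
    next
      case False
      have "(\<Sum>s\<in>V. (if s = fst e \<or> s = snd e then ?d else 0) * real (meetings P s ?t)) =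
         (\<Sum>s\<in>V. (if s = fst e then ?d * real (meetings P s ?t) else 0) +
                (if s = snd e then ?d * real (meetings P s ?t) else 0))"
        by (rule sum.cong) (use False in auto)
      also have "\<dots> = ?d * (real (meetings P (fst e) ?t) + real (meetings P (snd e) ?t))"
        using e finite_V by (auto simp: sum.distrib distrib_left)
      finally show ?thesis .
    qed
    finally show ?thesis .
  qed
  have "(\<Sum>p\<in>token_set. \<Sum>r\<in>slot_set. val p r) = (\<Sum>(e, k)\<in>(V \<times> V) \<times> {..<q}.
      token_gain h w (fst e) (snd e) k *
      (real (meetings P (fst e) (token (e, k))) + real (meetings P (snd e) (token (e, k)))))"
    unfolding token_set_def sum.reindex[OF inj_token] by (rule sum.cong) (auto simp: row)
  then show ?thesis by (simp add: f f2)
qed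

section \<open>From feasible partitions to configurations\<close>

lemma group_slot_unique:
  assumes P: "feasible P" and X: "X \<in> P" "slot (u, i) \<in> X" "slot (u, j) \<in> X"
    and u: "u \<in> V" "i < q" "j < q"
  shows "i = j"
proof (rule ccontr)
  assume "i \<noteq> j"
  then have "slot (u, i) \<noteq> slot (u, j)"
    using u inj_onD[OF inj_slot, of "(u, i)" "(u, j)"] by auto
  then have "w' (slot (u, i)) (slot (u, j)) \<noteq> -\<infinity>"
    using P X by (auto simp: feasible_def)
  then show False using u \<open>slot (u, i) \<noteq> slot (u, j)\<close> by (simp add: slot_slot)
qed

lemma group_token_unique:
  assumes P: "feasible P" and X: "X \<in> P" "token (e, k) \<in> X" "token (e, k') \<in> X"
    and e: "e \<in> V \<times> V" "k < q" "k' < q"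
  shows "k = k'"
proof (rule ccontr)
  assume "k \<noteq> k'"
  then have "token (e, k) \<noteq> token (e, k')"
    using e inj_onD[OF inj_token, of "(e, k)" "(e, k')"] by auto
  then have "w' (token (e, k)) (token (e, k')) \<noteq> -\<infinity>"
    using P X by (auto simp: feasible_def)
  then show False using e \<open>token (e, k) \<noteq> token (e, k')\<close> by (simp add: token_token)
qed

lemma finite_feasible: "feasible P \<Longrightarrow> finite P"
  using finite_V' finite_elements by (auto simp: feasible_def)

lemma size_config_of:
  assumes "feasible P"
  shows "size {#Y \<in># config_of P. Q Y#} = card {X \<in> P. Q (members X)}"
  using finite_feasible[OF assms]
  by (simp add: config_of_def filter_mset_image_mset filter_mset_mset_set)

text \<open>The \<open>q\<close> slots of \<open>u\<close> are pairwise enemies and hence lie in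
  \<open>q\<close> distinct groups, which are exactly the groups whose projection contains
  \<open>u\<close>.\<close>

lemma config_of_configuration:
  assumes P: "feasible P"
  shows "configuration q V (config_of P)"
proof -
  have part: "partition_on V' P" using P by (simp add: feasible_def)
  have "card {X \<in> P. u \<in> members X} = q" if u: "u \<in> V" for u
  proof -
    have slots: "slot (u, i) \<in> V'" if "i < q" for i using that u by (auto simp: V')
    have "bij_betw (\<lambda>i. group_of P (slot (u, i))) {..<q} {X \<in> P. u \<in> members X}"
    proof (rule bij_betw_imageI)
      show "inj_on (\<lambda>i. group_of P (slot (u, i))) {..<q}"
      proof (rule inj_onI)
        fix i j assume "i \<in> {..<q}" "j \<in> {..<q}"
          "group_of P (slot (u, i)) = group_of P (slot (u, j))"
        then show "i = j"
          using group_slot_unique[OF P, of "group_of P (slot (u, i))" u i j]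
            group_of_mem[OF part slots, of i] group_of_mem[OF part slots, of j] u by simp
      qed
      show "(\<lambda>i. group_of P (slot (u, i))) ` {..<q} = {X \<in> P. u \<in> members X}"
      proof (intro equalityI subsetI)
        fix X assume "X \<in> (\<lambda>i. group_of P (slot (u, i))) ` {..<q}"
        then show "X \<in> {X \<in> P. u \<in> members X}"
          using group_of_mem[OF part slots] u by (auto simp: members_def)
      next
        fix X assume "X \<in> {X \<in> P. u \<in> members X}"
        then obtain i where "i < q" "slot (u, i) \<in> X" "X \<in> P" by (auto simp: members_def)
        then show "X \<in> (\<lambda>i. group_of P (slot (u, i))) ` {..<q}"
          using group_of_eq[OF part] by (intro image_eqI[of _ _ i]) auto
      qed
    qed
    then show ?thesis using bij_betw_same_card by fastforce
  qed
  moreover have "X \<subseteq> V" if "X \<in># config_of P" for X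
    using that finite_feasible[OF P] by (auto simp: config_of_def members_def)
  ultimately show ?thesis
    by (simp add: configuration_def groups_of_def size_config_of[OF P])
qed

lemma shared_config_of:
  "feasible P \<Longrightarrow> shared_groups (config_of P) u v = card {X \<in> P. u \<in> members X \<and> v \<in> members X}"
  by (simp add: shared_groups_def size_config_of)

lemma config_of_no_enemies:
  assumes P: "feasible P" and uv: "u \<in> V" "v \<in> V" "u \<noteq> v" "w u v = -\<infinity>"
  shows "shared_groups (config_of P) u v = 0"
proof -
  have False if X: "X \<in> P" "u \<in> members X" "v \<in> members X" for X
  proof -
    obtain i j where ij: "i < q" "j < q" "slot (u, i) \<in> X" "slot (v, j) \<in> X"
      using X by (auto simp: members_def)
    have "slot (u, i) \<noteq> slot (v, j)"
      using ij uv inj_onD[OF inj_slot, of "(u, i)" "(v, j)"] by auto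
    moreover from this have "w' (slot (u, i)) (slot (v, j)) \<noteq> -\<infinity>"
      using P X ij by (auto simp: feasible_def)
    ultimately show False using uv ij by (simp add: slot_slot)
  qed
  then have "{X \<in> P. u \<in> members X \<and> v \<in> members X} = {}" by blast
  then show ?thesis by (simp only: shared_config_of[OF P] card.empty)
qed

lemma configuration_utility_eq:
  assumes "\<And>u v. u \<in> V \<Longrightarrow> v \<in> V \<Longrightarrow> u \<noteq> v \<Longrightarrow> w u v = -\<infinity> \<Longrightarrow> shared_groups D u v = 0"
  shows "global_configuration_utility h V w D = ereal (total (shared_groups D))"
proof -
  have "configuration_utility h V w D u = ereal (\<Sum>v\<in>V. share_sum u v (shared_groups D u v))"
    if u: "u \<in> V" for u
  proof -
    have "configuration_utility h V w D u =
        (\<Sum>v\<in>V - {u}. ereal (share_sum u v (shared_groups D u v)))"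
      unfolding configuration_utility_def using u assms share_eq by (intro sum.cong) auto
    also have "\<dots> = ereal (\<Sum>v\<in>V. share_sum u v (shared_groups D u v))"
      using finite_V u by (subst sum.remove[OF finite_V u]) (simp add: token_gain_def)
    finally show ?thesis .
  qed
  then show ?thesis by (simp add: global_configuration_utility_def total_def)
qed

text \<open>The counterpart of \<open>feasible_if_utility\<close> for configurations: by
  \<open>share_enemies\<close>, any positive number of groups shared by enemies already costs
  \<open>-\<infinity>\<close>.\<close>

lemma no_enemies_if_utility:
  assumes f: "global_configuration_utility h V w D \<noteq> -\<infinity>"
    and uv: "u \<in> V" "v \<in> V" "u \<noteq> v" "w u v = -\<infinity>"
  shows "shared_groups D u v = 0"
proof (rule ccontr)
  assume "shared_groups D u v \<noteq> 0"
  then have enemy: "h (shared_groups D u v) (w u v) = -\<infinity>"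
    using uv share_enemies[OF h] by simp
  have no_inf: "h g (w s t) \<noteq> \<infinity>" if "s \<in> V" "t \<in> V" "s \<noteq> t" for g s t
    using weight_nat[OF that] h(1) nat_weights_subset_int_weights
    by (auto simp: sharing_function_def)
  have "configuration_utility h V w D u = -\<infinity>"
    unfolding configuration_utility_def
    using uv enemy no_inf finite_V by (intro ereal_sum_eq_MInf[where i = v]) auto
  moreover have "configuration_utility h V w D s \<noteq> \<infinity>" if "s \<in> V" for s
    unfolding configuration_utility_def using that no_inf by (intro ereal_sum_neq_PInf) auto
  ultimately have "global_configuration_utility h V w D = -\<infinity>"
    unfolding global_configuration_utility_def
    using uv finite_V by (intro ereal_sum_eq_MInf[where i = u]) auto
  with f show False by simp
qed

section \<open>The upper bound and its attainment\<close>

lemma sum_pairs: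
  "(\<Sum>(e, k)\<in>(V \<times> V) \<times> {..<q}. f e k) = (\<Sum>u\<in>V. \<Sum>v\<in>V. \<Sum>k<q. f (u, v) k)"
  for f :: "'a \<times> 'a \<Rightarrow> nat \<Rightarrow> real"
  by (simp add: sum.cartesian_product')

text \<open>Compared separately for each ordered pair. A token meets at most one slot of either
  player, so it earns once, and a second time only if its index lies in the set \<open>?K\<close> of
  tokens whose group holds both players.\<close>

lemma utility_le:
  assumes P: "feasible P"
  shows "global_partition_utility V' w' P \<le>
    ereal (2 * (total (\<lambda>_ _. q) + total (shared_groups (config_of P))))"
proof -
  have part: "partition_on V' P" using P by (simp add: feasible_def)
  have "(\<Sum>k<q. token_gain h w u v k *
        (real (meetings P u (token ((u, v), k))) + real (meetings P v (token ((u, v), k)))))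
      \<le> share_sum u v q + share_sum u v (shared_groups (config_of P) u v)"
    if uv: "u \<in> V" "v \<in> V" for u v
  proof -
    let ?t = "\<lambda>k. token ((u, v), k)"
    let ?K = "{k. k < q \<and> u \<in> members (group_of P (?t k)) \<and> v \<in> members (group_of P (?t k))}"
    have tok: "?t k \<in> V'" if "k < q" for k using that uv by (auto simp: V')
    have meet: "meetings P s (?t k) \<le> (if s \<in> members (group_of P (?t k)) then 1 else 0)"
      if s: "s \<in> V" "k < q" for s k
    proof -
      have "card {i. i < q \<and> slot (s, i) \<in> group_of P (?t k)} \<le> 1"
        using group_slot_unique[OF P group_of_mem(1)[OF part tok[OF s(2)]], of s] s(1)
        by (auto simp: card_le_Suc0_iff_eq)
      then show ?thesis
        using s by (auto simp: meetings_def members_def)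
    qed
    have "(\<Sum>k<q. token_gain h w u v k * (real (meetings P u (?t k)) + real (meetings P v (?t k))))
        \<le> (\<Sum>k<q. token_gain h w u v k + (if k \<in> ?K then token_gain h w u v k else 0))"
    proof (rule sum_mono)
      fix k assume "k \<in> {..<q}"
      then have k: "k < q" by simp
      have "meetings P u (?t k) + meetings P v (?t k) \<le> 1 + (if k \<in> ?K then 1 else 0)"
        using meet[OF uv(1) k] meet[OF uv(2) k] k by (auto split: if_splits)
      then have "real (meetings P u (?t k)) + real (meetings P v (?t k))
          \<le> 1 + (if k \<in> ?K then 1 else 0)"
        by (simp split: if_splits)
      from mult_left_mono[OF this token_gain_nonneg[OF uv, of k]]
      show "token_gain h w u v k * (real (meetings P u (?t k)) + real (meetings P v (?t k)))
          \<le> token_gain h w u v k + (if k \<in> ?K then token_gain h w u v k else 0)"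
        by (auto simp: distrib_left split: if_splits)
    qed
    also have "\<dots> = share_sum u v q + (\<Sum>k\<in>?K. token_gain h w u v k)"
      by (simp add: sum.distrib sum.inter_restrict[symmetric] Int_def flip: sum.inter_filter)
    \<comment> \<open>Here concavity enters: the gains do not increase with \<open>k\<close>, so the
      initial segment of the same size is worth at least as much.\<close>
    also have "(\<Sum>k\<in>?K. token_gain h w u v k) \<le> share_sum u v (card ?K)"
      by (rule sum_antimono_le) (use token_gain_antimono[OF uv] in auto)
    also have "share_sum u v (card ?K) \<le> share_sum u v (shared_groups (config_of P) u v)"
    proof (rule sum_mono2)
      \<comment> \<open>Tokens of one pair are enemies, so those in \<open>?K\<close> occupy
        distinct groups, all shared by \<open>u\<close> and \<open>v\<close>.\<close>
      have "card ?K \<le> card {X \<in> P. u \<in> members X \<and> v \<in> members X}"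
      proof (rule card_inj_on_le[where f = "\<lambda>k. group_of P (?t k)"])
        show "inj_on (\<lambda>k. group_of P (?t k)) ?K"
          using group_token_unique[OF P] group_of_mem[OF part tok] uv
          by (intro inj_onI) (metis (no_types, lifting) mem_Collect_eq mem_Sigma_iff)
      qed (use group_of_mem[OF part tok] finite_feasible[OF P] in auto)
      then show "{..<card ?K} \<subseteq> {..<shared_groups (config_of P) u v}"
        by (simp add: shared_config_of[OF P])
    qed (use token_gain_nonneg[OF uv] in auto)
    finally show ?thesis by simp
  qed
  then show ?thesis
    unfolding utility_eq[OF P] sum_pairs total_def
    by (simp add: sum.distrib[symmetric] sum_mono)
qed

text \<open>Every slot and token is assigned to an occurrence of a group in \<open>D\<close>, and
  the partition is formed by the fibres of this assignment. The slots of \<open>u\<close> run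
  through its groups, and so do the tokens of \<open>(u, v)\<close>, but starting with the groups
  shared with \<open>v\<close>.\<close>

lemma configuration_partition:
  assumes D: "configuration q V D"
    and enemies: "\<And>u v. u \<in> V \<Longrightarrow> v \<in> V \<Longrightarrow> u \<noteq> v \<Longrightarrow> w u v = -\<infinity> \<Longrightarrow> shared_groups D u v = 0"
  obtains P where "partition_on V' P"
    "ereal (2 * (total (\<lambda>_ _. q) + total (shared_groups D))) \<le> global_partition_utility V' w' P"
proof -
  \<comment> \<open>Indices into a list distinguish repeated occurrences of the same group in
    \<open>D\<close>.\<close>
  obtain Ds where Ds: "mset Ds = D" using ex_mset by blast
  have size: "size {#X \<in># D. Q X#} = card {l. l < length Ds \<and> Q (Ds ! l)}" for Q
    unfolding Ds[symmetric] mset_filter[symmetric] size_mset by (rule length_filter_conv_card)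
  define I where "I u = {l. l < length Ds \<and> u \<in> Ds ! l}" for u
  have fin_I: "finite (I u)" for u by (simp add: I_def)
  have card_I: "card (I u) = q" if "u \<in> V" for u
    using D that by (simp add: configuration_def groups_of_def size I_def)
  have shared: "shared_groups D u v = card (I u \<inter> I v)" for u v
    unfolding shared_groups_def size I_def by (rule arg_cong[where f = card]) auto
  have "\<exists>b. bij_betw b {..<q} (I u)" if "u \<in> V" for u
    using enumeration_prefix[OF fin_I subset_refl, of u] card_I[OF that] by metis
  then obtain b where b: "\<And>u. u \<in> V \<Longrightarrow> bij_betw (b u) {..<q} (I u)" by metis
  \<comment> \<open>Shared groups come first, so it is the tokens of smallest index, those of
    largest gain, that earn twice.\<close>
  have "\<exists>c. bij_betw c {..<q} (I u) \<and> (\<forall>k<shared_groups D u v. c k \<in> I v)" if "u \<in> V" for u v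
    using enumeration_prefix[OF fin_I Int_lower1, of u "I v"] card_I[OF that] shared
    by (metis IntD2)
  then obtain c where c: "\<And>u v. u \<in> V \<Longrightarrow> bij_betw (c u v) {..<q} (I u)"
    "\<And>u v k. u \<in> V \<Longrightarrow> k < shared_groups D u v \<Longrightarrow> c u v k \<in> I v" by metis
  define \<phi> where "\<phi> p = (if p \<in> slot_set then (case inv_into (V \<times> {..<q}) slot p of (u, i) \<Rightarrow> b u i)
    else (case inv_into ((V \<times> V) \<times> {..<q}) token p of ((u, v), k) \<Rightarrow> c u v k))" for p
  have \<phi>_slot: "\<phi> (slot (u, i)) = b u i" if "u \<in> V" "i < q" for u i
    using that inv_into_f_f[OF inj_slot, of "(u, i)"] by (auto simp: \<phi>_def slot_set_def)
  have \<phi>_token: "\<phi> (token ((u, v), k)) = c u v k" if "u \<in> V" "v \<in> V" "k < q" for u v k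
  proof -
    have "token ((u, v), k) \<in> token_set" using that by (auto simp: token_set_def)
    then show ?thesis
      using that inv_into_f_f[OF inj_token, of "((u, v), k)"] V'_eq(2) by (auto simp: \<phi>_def)
  qed
  define P where "P = fibres \<phi> V'"
  have part: "partition_on V' P" unfolding P_def by (rule partition_on_fibres)
  have inj: "i = j" if "u \<in> V" "i < q" "j < q" "b u i = b u j" for u i j
    using that bij_betw_imp_inj_on[OF b] by (auto simp: inj_on_def)
  have inj': "i = j" if "u \<in> V" "i < q" "j < q" "c u v i = c u v j" for u v i j
    using that bij_betw_imp_inj_on[OF c(1)] by (auto simp: inj_on_def)
  have b_in: "b u i \<in> I u" if "u \<in> V" "i < q" for u i
    using that bij_betwE[OF b] by auto
  have c_in: "c u v i \<in> I u" if "u \<in> V" "i < q" for u v i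
    using that bij_betwE[OF c(1)] by auto
  have players: "(\<exists>u i. p = slot (u, i) \<and> u \<in> V \<and> i < q) \<or>
      (\<exists>e k. p = token (e, k) \<and> e \<in> V \<times> V \<and> k < q)" if "p \<in> V'" for p
    using that unfolding V' by blast
  have "w' p r \<noteq> -\<infinity>" if pr: "p \<in> V'" "r \<in> V'" "p \<noteq> r" "\<phi> p = \<phi> r" for p r
  proof -
    consider (ss) u i v j where "p = slot (u, i)" "r = slot (v, j)" "u \<in> V" "v \<in> V" "i < q" "j < q"
      | (st) u i e k where "p = slot (u, i)" "r = token (e, k)" "u \<in> V" "i < q" "e \<in> V \<times> V" "k < q"
      | (ts) u i e k where "r = slot (u, i)" "p = token (e, k)" "u \<in> V" "i < q" "e \<in> V \<times> V" "k < q"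
      | (tt) e k e' k' where "p = token (e, k)" "r = token (e', k')"
          "e \<in> V \<times> V" "k < q" "e' \<in> V \<times> V" "k' < q"
      using players[OF pr(1)] players[OF pr(2)] by metis
    then show ?thesis
    proof cases
      case ss
      then have eq: "b u i = b v j" using pr(4) by (simp add: \<phi>_slot)
      \<comment> \<open>Two slots with one label thus belong to different players sharing a group of
        \<open>D\<close>, and these cannot be enemies.\<close>
      then have uv: "u \<noteq> v" using ss pr(3) inj by blast
      have "b u i \<in> I u \<inter> I v" using eq ss b_in by (metis IntI)
      then have "shared_groups D u v \<noteq> 0" using fin_I by (auto simp: shared)
      then show ?thesis using enemies[of u v] ss uv pr(3) by (auto simp: slot_slot)
    next
      case tt
      \<comment> \<open>Tokens of the same pair receive different labels, \<open>c\<close> being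
        injective for each pair.\<close>
      then have "e \<noteq> e'" using pr(3,4) inj'[of "fst e" k k' "snd e"] by (auto simp: \<phi>_token)
      then show ?thesis using tt pr(3) by (auto simp: token_token)
    qed (simp_all add: slot_token token_slot)
  qed
  then have feas: "feasible P"
    using part by (auto simp: feasible_def P_def fibres_def)
  have meet: "meetings P s (token ((u, v), k)) = card {i. i < q \<and> b s i = c u v k}"
    if "u \<in> V" "v \<in> V" "s \<in> V" "k < q" for s u v k
  proof -
    have tok: "token ((u, v), k) \<in> V'" using that by (auto simp: V')
    have "slot (s, i) \<in> V'" if "i < q" for i using that \<open>s \<in> V\<close> by (auto simp: V')
    then have "{i. i < q \<and> slot (s, i) \<in> group_of P (token ((u, v), k))} =
        {i. i < q \<and> b s i = c u v k}"
      using that by (auto simp: P_def group_of_fibres[OF tok] \<phi>_slot \<phi>_token)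
    then show ?thesis by (simp add: meetings_def)
  qed
  have meet_pos: "1 \<le> meetings P s (token ((u, v), k))"
    if uvs: "u \<in> V" "v \<in> V" "s \<in> V" "k < q" and mem: "c u v k \<in> I s" for s u v k
  proof -
    obtain i where "i < q" "b s i = c u v k"
      using bij_betw_imp_surj_on[OF b[OF uvs(3)]] mem by (metis imageE lessThan_iff)
    then have "{i. i < q \<and> b s i = c u v k} \<noteq> {}" by auto
    then show ?thesis using uvs by (simp add: meet Suc_le_eq card_gt_0_iff)
  qed
  have "share_sum u v q + share_sum u v (shared_groups D u v) \<le> (\<Sum>k<q. token_gain h w u v k *
        (real (meetings P u (token ((u, v), k))) + real (meetings P v (token ((u, v), k)))))"
    if uv: "u \<in> V" "v \<in> V" for u v
  proof -
    let ?g = "shared_groups D u v"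
    \<comment> \<open>The shared groups are among the \<open>q\<close> groups of \<open>u\<close>,
      so the segment of doubly earning tokens fits into \<open>{..<q}\<close>.\<close>
    have "?g \<le> q" using card_mono[OF fin_I Int_lower1, of u "I v"] card_I[OF uv(1)] by (simp add: shared)
    then have "share_sum u v ?g = (\<Sum>k<q. if k < ?g then token_gain h w u v k else 0)"
      by (intro sum.mono_neutral_cong_left) auto
    then have "share_sum u v q + share_sum u v ?g =
        (\<Sum>k<q. token_gain h w u v k + (if k < ?g then token_gain h w u v k else 0))"
      by (simp add: sum.distrib)
    also have "\<dots> \<le> (\<Sum>k<q. token_gain h w u v k *
        (real (meetings P u (token ((u, v), k))) + real (meetings P v (token ((u, v), k)))))"
    proof (rule sum_mono)
      fix k assume "k \<in> {..<q}"
      then have k: "k < q" by simp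
      have "1 \<le> meetings P u (token ((u, v), k))"
        using meet_pos[OF uv uv(1) k] c_in[OF uv(1) k] by simp
      moreover have "1 \<le> meetings P v (token ((u, v), k))" if "k < ?g"
        using meet_pos[OF uv uv(2) k] c(2)[OF uv(1) that] by simp
      ultimately have "1 + (if k < ?g then 1 else 0) \<le>
          real (meetings P u (token ((u, v), k))) + real (meetings P v (token ((u, v), k)))"
        by auto
      from mult_left_mono[OF this token_gain_nonneg[OF uv, of k]]
      show "token_gain h w u v k + (if k < ?g then token_gain h w u v k else 0) \<le>
          token_gain h w u v k *
          (real (meetings P u (token ((u, v), k))) + real (meetings P v (token ((u, v), k))))"
        by (simp add: distrib_left split: if_splits)
    qed
    finally show ?thesis .
  qed
  then have "ereal (2 * (total (\<lambda>_ _. q) + total (shared_groups D))) \<le> global_partition_utility V' w' P"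
    unfolding utility_eq[OF feas] sum_pairs total_def
    by (simp add: sum.distrib[symmetric] sum_mono)
  with part show thesis by (rule that)
qed

text \<open>The partition into singletons has utility 0, so a maximum cannot be
  \<open>-\<infinity>\<close>.\<close>

lemma maximum_partition_feasible:
  assumes max: "maximum_partition V' w' P"
  shows "feasible P"
proof -
  let ?S = "fibres id V'"
  have "global_partition_utility V' w' ?S = 0"
    unfolding global_partition_utility_def partition_utility_def
    by (intro sum.neutral ballI) (auto simp: group_of_fibres)
  then have "0 \<le> global_partition_utility V' w' P"
    using max partition_on_fibres[of V' id] unfolding maximum_partition_def by metis
  then show ?thesis
    using max by (intro feasible_if_utility) (auto simp: maximum_partition_def)
qed

lemma maximum_config_of:
  assumes max: "maximum_partition V' w' P"
  shows "maximum_configuration q h V w (config_of P)"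
  unfolding maximum_configuration_def
proof (intro conjI allI impI)
  have feas: "feasible P" using max by (rule maximum_partition_feasible)
  then show "configuration q V (config_of P)" by (rule config_of_configuration)
  fix D assume D: "configuration q V D"
  show "global_configuration_utility h V w D \<le> global_configuration_utility h V w (config_of P)"
  proof (cases "global_configuration_utility h V w D = -\<infinity>")
    case False
    then have enemies: "shared_groups D u v = 0"
      if "u \<in> V" "v \<in> V" "u \<noteq> v" "w u v = -\<infinity>" for u v
      using no_enemies_if_utility that by blast
    obtain Q where Q: "partition_on V' Q"
      "ereal (2 * (total (\<lambda>_ _. q) + total (shared_groups D))) \<le> global_partition_utility V' w' Q"
      by (rule configuration_partition[OF D]) (use enemies in auto)
    note Q(2)
    also have "global_partition_utility V' w' Q \<le> global_partition_utility V' w' P"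
      using max Q(1) by (simp add: maximum_partition_def)
    also have "\<dots> \<le> ereal (2 * (total (\<lambda>_ _. q) + total (shared_groups (config_of P))))"
      by (rule utility_le[OF feas])
    \<comment> \<open>Both bounds contain the same finite constant
      \<open>total (\<lambda>_ _. q)\<close>, which cancels.\<close>
    finally have "total (shared_groups D) \<le> total (shared_groups (config_of P))"
      by simp
    moreover have "global_configuration_utility h V w D = ereal (total (shared_groups D))"
      by (rule configuration_utility_eq) (rule enemies)
    moreover have "global_configuration_utility h V w (config_of P) =
        ereal (total (shared_groups (config_of P)))"
      by (rule configuration_utility_eq) (rule config_of_no_enemies[OF feas])
    ultimately show ?thesis by simp
  qed simp
qed

end


section \<open>Numbering slots and tokens\<close>

text \<open>The number equals \<open>(a * q + i) * n + u\<close>, a mixed-radix representation whose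
  digits division and remainder recover.\<close>

lemma decode_player:
  fixes n q a i u :: nat
  assumes "u < n" "i < q"
  shows "(a * (n * q) + (i * n + u)) mod n = u"
    and "(a * (n * q) + (i * n + u)) div n mod q = i"
    and "(a * (n * q) + (i * n + u)) div (n * q) = a"
proof -
  have p: "a * (n * q) + (i * n + u) = (a * q + i) * n + u" by (simp add: algebra_simps)
  have d: "((a * q + i) * n + u) div n = a * q + i" using assms by simp
  show "(a * (n * q) + (i * n + u)) mod n = u" using assms by (simp add: p)
  show "(a * (n * q) + (i * n + u)) div n mod q = i" using assms by (simp only: p d) simp
  show "(a * (n * q) + (i * n + u)) div (n * q) = a" using assms by (simp only: p d div_mult2_eq) simp
qed

lemma encode_player:
  fixes n q p :: nat
  shows "p = p div (n * q) * (n * q) + (p div n mod q * n + p mod n)"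
proof -
  have eq: "d * (n * q) + (m * n + x) = (d * q + m) * n + x" for d m x :: nat
    by (simp add: algebra_simps)
  show ?thesis unfolding div_mult2_eq eq by simp
qed

locale numbered_players =
  fixes V :: "'a set" and vs :: "'a list" and q :: nat
  assumes vs: "distinct vs" "set vs = V"
begin

definition pos :: "'a \<Rightarrow> nat" where "pos = inv_into {..<length vs} ((!) vs)"

definition slot :: "'a \<times> nat \<Rightarrow> nat" where
  "slot = (\<lambda>(u, i). i * length vs + pos u)"

definition token :: "('a \<times> 'a) \<times> nat \<Rightarrow> nat" where
  "token = (\<lambda>((u, v), i). Suc (pos v) * (length vs * q) + (i * length vs + pos u))"

lemma bij_vs: "bij_betw ((!) vs) {..<length vs} V"
  using vs by (intro bij_betw_nth) auto

lemma pos: "u \<in> V \<Longrightarrow> pos u < length vs" "u \<in> V \<Longrightarrow> vs ! pos u = u"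
  using bij_vs by (auto simp: pos_def bij_betw_def f_inv_into_f inv_into_into[of _ "(!) vs" "{..<length vs}", simplified])

lemma pos_nth: "i < length vs \<Longrightarrow> pos (vs ! i) = i"
  using bij_vs by (simp add: pos_def bij_betw_def inv_into_f_f)

lemma pos_inj: "u \<in> V \<Longrightarrow> v \<in> V \<Longrightarrow> pos u = pos v \<longleftrightarrow> u = v"
  using pos(2) by metis

lemma decode_slot:
  assumes "u \<in> V" "i < q"
  shows "slot (u, i) mod length vs = pos u" "slot (u, i) div length vs mod q = i"
    "slot (u, i) div (length vs * q) = 0"
  using decode_player[OF pos(1) assms(2), OF assms(1), of 0] by (simp_all add: slot_def)

lemma decode_token:
  assumes "u \<in> V" "v \<in> V" "i < q"
  shows "token ((u, v), i) mod length vs = pos u" "token ((u, v), i) div length vs mod q = i"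
    "token ((u, v), i) div (length vs * q) = Suc (pos v)"
  using decode_player[OF pos(1) assms(3), OF assms(1), of "Suc (pos v)"]
  by (simp_all only: token_def prod.case)

lemma slot_eq:
  assumes "p < length vs * q"
  shows "p = slot (vs ! (p mod length vs), p div length vs)" "vs ! (p mod length vs) \<in> V"
    "p div length vs < q"
proof -
  have n: "0 < length vs" using assms by (cases "length vs") auto
  then show "vs ! (p mod length vs) \<in> V" using vs by auto
  show "p = slot (vs ! (p mod length vs), p div length vs)"
    using n by (simp add: slot_def pos_nth)
  show "p div length vs < q" using assms by (simp add: less_mult_imp_div_less mult.commute)
qed

lemma token_eq:
  assumes "length vs * q \<le> p" "p < length vs * q * (length vs + 1)"
  defines "u \<equiv> vs ! (p mod length vs)" and "v \<equiv> vs ! (p div (length vs * q) - 1)"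
  shows "p = token ((u, v), p div length vs mod q)" "u \<in> V" "v \<in> V" "p div length vs mod q < q"
proof -
  have n: "0 < length vs" "0 < q" using assms(2) by (auto intro!: Nat.gr0I)
  have "p div (length vs * q) < length vs + 1"
    using assms(2) by (simp add: less_mult_imp_div_less mult.commute)
  \<comment> \<open>A positive quotient makes the truncated subtraction in \<open>v\<close> exact:
    block 0 belongs to the slots.\<close>
  moreover have "0 < p div (length vs * q)"
    using assms(1) n by (simp add: div_greater_zero_iff)
  ultimately obtain a where a: "p div (length vs * q) = Suc a" "a < length vs"
    by (cases "p div (length vs * q)") auto
  show "u \<in> V" "v \<in> V" "p div length vs mod q < q"
    using n a vs by (auto simp: u_def v_def)
  show "p = token ((u, v), p div length vs mod q)"
    using encode_player[of p "length vs" q] a n by (simp add: token_def u_def v_def pos_nth)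
qed

lemma slot_less:
  assumes "u \<in> V" "i < q"
  shows "slot (u, i) < length vs * q"
proof -
  have "0 < length vs * q" using assms vs by (auto simp: length_pos_if_in_set)
  then show ?thesis using decode_slot(3)[OF assms] by (simp add: div_eq_0_iff)
qed

lemma token_bounds:
  assumes "u \<in> V" "v \<in> V" "i < q"
  shows "length vs * q \<le> token ((u, v), i)" "token ((u, v), i) < length vs * q * (length vs + 1)"
proof -
  have nq: "0 < length vs * q" using assms vs by (auto simp: length_pos_if_in_set)
  show "length vs * q \<le> token ((u, v), i)" by (simp add: token_def)
  have "token ((u, v), i) div (length vs * q) < length vs + 1"
    using decode_token(3)[OF assms] pos(1)[OF assms(2)] by simp
  then show "token ((u, v), i) < length vs * q * (length vs + 1)"
    using nq by (simp add: div_less_iff_less_mult mult.commute)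
qed

lemma players_eq:
  "{..<length vs * q * (length vs + 1)} =
    slot ` (V \<times> {..<q}) \<union> token ` ((V \<times> V) \<times> {..<q})" (is "_ = ?S \<union> ?T")
proof (intro equalityI subsetI)
  fix p assume "p \<in> {..<length vs * q * (length vs + 1)}"
  then have p: "p < length vs * q * (length vs + 1)" by simp
  show "p \<in> ?S \<union> ?T"
  proof (cases "p < length vs * q")
    case True
    show ?thesis by (rule UnI1, rule image_eqI, rule slot_eq(1)[OF True]) (use slot_eq[OF True] in auto)
  next
    case False
    then have le: "length vs * q \<le> p" by simp
    show ?thesis
      by (rule UnI2, rule image_eqI, rule token_eq(1)[OF le p]) (use token_eq[OF le p] in auto)
  qed
next
  fix p assume "p \<in> ?S \<union> ?T"
  then show "p \<in> {..<length vs * q * (length vs + 1)}"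
    using slot_less token_bounds by (auto intro: trans_less_add1)
qed

text \<open>The matrix computed by the program is an instance of the abstract game. Injectivity
  follows from the decoding equations, disjointness from comparison with
  \<open>length vs * q\<close>.\<close>

lemma slot_token_game:
  assumes h: "sharing_function h" "concave_sharing h"
    and game: "coloring_game V w" "weights_in nat_weights V w"
    and W: "\<And>i j. i < length vs \<Longrightarrow> j < length vs \<Longrightarrow> W i j = w (vs ! i) (vs ! j)"
    and N: "N = length vs * q * (length vs + 1)"
    and w': "\<And>p r. p < N \<Longrightarrow> r < N \<Longrightarrow> w' p r = new_weight h (length vs) q W p r"
  shows "slot_token_game q h V w slot token {..<N} w'"
proof -
  have slot_N: "slot (u, i) < N" if "u \<in> V" "i < q" for u i
    using slot_less[OF that] by (simp add: N)
  have token_N: "token ((u, v), i) < N" if "u \<in> V" "v \<in> V" "i < q" for u v i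
    using token_bounds[OF that] by (simp add: N)
  have W_pos: "W (pos u) (pos v) = w u v" if "u \<in> V" "v \<in> V" for u v
    using that by (simp add: W pos)
  have slot_token: "slot_token_weight h W (pos s) (pos u) (pos v) k =
      ereal (if s = u \<or> s = v then token_gain h w u v k else 0)" if "s \<in> V" "u \<in> V" "v \<in> V" for s u v k
  proof (cases "u \<noteq> v \<and> w u v \<noteq> -\<infinity>")
    case True
    then have "w u v \<in> nat_weights" using that game(2) by (simp add: weights_in_def)
    then show ?thesis
      using ereal_gain[OF h] True that
      by (simp add: slot_token_weight_def token_gain_def W_pos pos_inj zero_ereal_def)
  qed (use that in \<open>auto simp: slot_token_weight_def token_gain_def W_pos pos_inj zero_ereal_def\<close>)
  show ?thesis
  proof (unfold_locales, rule h(1), rule h(2), rule game(1), rule game(2))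
    show "{..<N} = slot ` (V \<times> {..<q}) \<union> token ` ((V \<times> V) \<times> {..<q})"
      unfolding N by (rule players_eq)
    show "inj_on slot (V \<times> {..<q})"
      by (intro inj_onI) (clarsimp, metis decode_slot(1,2) pos(2))
    show "inj_on token ((V \<times> V) \<times> {..<q})"
      by (intro inj_onI) (clarsimp, metis decode_token pos(2) nat.inject)
    show "slot ` (V \<times> {..<q}) \<inter> token ` ((V \<times> V) \<times> {..<q}) = {}"
      using slot_less token_bounds(1) by (fastforce simp: not_less[symmetric])
  qed (auto simp: w' slot_N token_N new_weight_def decode_slot decode_token cell_weight_def
      W_pos pos_inj slot_token split: if_splits)
qed

end

text \<open>Correctness and cost of the decoding, for an arbitrary listing of the groups and their
  members. The decoded lists spell out \<open>config_of P\<close>.\<close>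

lemma encodes_groups_decoded:
  assumes "numbered_players V vs"
    and game: "slot_token_game q h V w (numbered_players.slot vs) (numbered_players.token vs q) {..<N} w'"
    and N: "length vs * q \<le> N"
    and P: "maximum_partition {..<N} w' P"
    and xss: "encodes_groups [0..<N] xss (mset_set P)"
  shows "\<exists>C. encodes_groups vs (map (slot_owners (length vs) q) xss) C \<and> maximum_configuration q h V w C"
    and "(\<Sum>xs\<leftarrow>xss. 6 + length xs * (2 * q + 7)) \<le> (2 * q + 13) * N"
proof -
  interpret numbered_players V vs q by (rule assms(1))
  interpret slot_token_game q h V w slot token "{..<N}" w' by (rule game)
  have feas: "feasible P" using P by (rule maximum_partition_feasible)
  then have part: "partition_on {..<N} P" by (simp add: feasible_def)
  have xs: "distinct xs" "set xs \<subseteq> {..<N}" if "xs \<in> set xss" for xs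
    using xss that by (auto simp: encodes_groups_def)
  have sets: "map (\<lambda>xs. (!) [0..<N] ` set xs) xss = map set xss"
  proof (rule map_cong[OF refl])
    fix xs assume "xs \<in> set xss"
    from xs(2)[OF this] have "\<forall>p\<in>set xs. [0..<N] ! p = p" by auto
    then show "(!) [0..<N] ` set xs = set xs" by simp
  qed
  have mset: "mset (map set xss) = mset_set P"
    using xss unfolding encodes_groups_def sets by blast
  have in_P: "set xs \<in> P" if "xs \<in> set xss" for xs
  proof -
    have "set xs \<in># mset (map set xss)" using that by auto
    then show ?thesis
      unfolding mset using finite_feasible[OF feas] by simp
  qed
  let ?n = "length vs"
  have owners: "distinct (slot_owners ?n q xs) \<and> set (slot_owners ?n q xs) \<subseteq> {..<?n}"
    and image: "(!) vs ` set (slot_owners ?n q xs) = members (set xs)"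
    if "xs \<in> set xss" for xs
  proof -
    \<comment> \<open>Feasibility guarantees that no owner is repeated: two slots with the same
      owner in one group would be enemies.\<close>
    have "inj_on (\<lambda>p. p mod ?n) (set (filter (\<lambda>p. p < ?n * q) xs))"
    proof (rule inj_onI)
      fix p r assume pr: "p \<in> set (filter (\<lambda>p. p < ?n * q) xs)" "r \<in> set (filter (\<lambda>p. p < ?n * q) xs)"
        "p mod ?n = r mod ?n"
      then have lt: "p < ?n * q" "r < ?n * q" by auto
      have "p div ?n = r div ?n"
        using group_slot_unique[OF feas in_P[OF that], of "vs ! (p mod ?n)" "p div ?n" "r div ?n"]
          slot_eq[OF lt(1)] slot_eq[OF lt(2)] pr by simp
      then show "p = r" using pr(3) by (metis div_mult_mod_eq)
    qed
    moreover have "p mod ?n < ?n" if "p < ?n * q" for p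
      using that by (cases "?n = 0") auto
    ultimately show "distinct (slot_owners ?n q xs) \<and> set (slot_owners ?n q xs) \<subseteq> {..<?n}"
      using xs(1)[OF that] by (auto simp: slot_owners_def distinct_map)
    show "(!) vs ` set (slot_owners ?n q xs) = members (set xs)"
    proof (intro equalityI subsetI)
      fix u assume "u \<in> (!) vs ` set (slot_owners ?n q xs)"
      then obtain p where "p \<in> set xs" "p < ?n * q" "u = vs ! (p mod ?n)"
        by (auto simp: slot_owners_def)
      then show "u \<in> members (set xs)"
        using slot_eq[of p] by (auto simp: members_def)
    next
      fix u assume "u \<in> members (set xs)"
      then obtain i where i: "u \<in> V" "i < q" "slot (u, i) \<in> set xs" by (auto simp: members_def)
      then have "pos u \<in> set (slot_owners ?n q xs)"
        using decode_slot(1)[OF i(1,2)] slot_less[OF i(1,2)] by (force simp: slot_owners_def)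
      then show "u \<in> (!) vs ` set (slot_owners ?n q xs)"
        using pos(2)[OF i(1)] by (metis image_eqI)
    qed
  qed
  have groups: "map (\<lambda>xs. (!) vs ` set xs) (map (slot_owners ?n q) xss) = map members (map set xss)"
    using image by simp
  have "mset (map (\<lambda>xs. (!) vs ` set xs) (map (slot_owners ?n q) xss)) = config_of P"
    unfolding groups mset_map[of members] mset config_of_def ..
  then have "encodes_groups vs (map (slot_owners ?n q) xss) (config_of P)"
    using owners by (simp add: encodes_groups_def)
  then show "\<exists>C. encodes_groups vs (map (slot_owners ?n q) xss) C \<and> maximum_configuration q h V w C"
    using maximum_config_of[OF P] by blast
  have "(\<Sum>xs\<leftarrow>xss. 6 + length xs * (2 * q + 7)) \<le> (\<Sum>xs\<leftarrow>xss. (2 * q + 13) * card (set xs))"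
  proof (rule sum_list_mono)
    fix xs assume x: "xs \<in> set xss"
    \<comment> \<open>Groups of a partition are non-empty, so the fixed cost 6 of a group can be
      charged to one of its members.\<close>
    have "set xs \<noteq> {}" using in_P[OF x] part by (auto simp: partition_on_def)
    then have "1 \<le> length xs" by (cases xs) auto
    then have "6 + length xs * (2 * q + 7) \<le> (2 * q + 13) * length xs"
      by (simp add: algebra_simps)
    then show "6 + length xs * (2 * q + 7) \<le> (2 * q + 13) * card (set xs)"
      using xs(1)[OF x] by (simp add: distinct_card)
  qed
  also have "\<dots> = (2 * q + 13) * sum_list (map card (map set xss))"
    by (simp add: sum_list_const_mult comp_def)
  also have "sum_list (map card (map set xss)) = sum_mset (image_mset card (mset (map set xss)))"
    by (metis mset_map sum_mset_sum_list)
  also have "\<dots> = (\<Sum>X\<in>P. card X)" unfolding mset by (simp add: sum_unfold_sum_mset)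
  \<comment> \<open>The groups are disjoint and cover all \<open>N\<close> players, so the lengths
    of the lists add up to \<open>N\<close>.\<close>
  also have "\<dots> = card (\<Union>P)"
    using part finite_V' by (intro card_Union_disjoint[symmetric])
      (auto simp: partition_on_def disjoint_def pairwise_def disjnt_def intro: finite_subset)
  also have "\<Union>P = {..<N}" using part by (simp add: partition_on_def)
  finally show "(\<Sum>xs\<leftarrow>xss. 6 + length xs * (2 * q + 7)) \<le> (2 * q + 13) * N" by simp
qed

text \<open>Programs and constants are chosen before the game, hence uniform over all games and all
  listings of a maximum partition. The construction runs in polynomial time and the deduction in
  time linear in the number of new players.\<close>

theorem theorem10:
  fixes q :: nat and h :: "nat \<Rightarrow> ereal \<Rightarrow> ereal"
  assumes "q \<ge> 1"
    and "sharing_function h"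
    and "concave_sharing h"
  shows "\<exists>(construct :: com) (deduce :: com) (a :: nat) (k :: nat) (b :: nat).
    \<forall>(V :: 'a set) (w :: 'a \<Rightarrow> 'a \<Rightarrow> ereal) (vs :: 'a list).
      coloring_game V w \<and> weights_in nat_weights V w \<and> distinct vs \<and> set vs = V \<longrightarrow>
      (\<exists>t s. exec h construct (game_input vs w) t s \<and> t \<le> a * (card V + 1) ^ k \<and>
         (let V' = {..<output_size s}; w' = output_weight s in
            coloring_game V' w' \<and>
            (\<forall>P xss. maximum_partition V' w' P \<and>
               encodes_groups [0..<output_size s] xss (mset_set P) \<longrightarrow>
               (\<exists>t' s' C. exec h deduce (partition_input (card V) xss) t' s' \<and>
                  t' \<le> b * (card V' + 1) \<and>
                  encodes_groups vs (output_groups s') C \<and>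
                  maximum_configuration q h V w C))))"
\<comment> \<open>The witnesses depend on \<open>q\<close> alone; \<open>h\<close> enters the runs
  only as an oracle.\<close>
proof (rule exI[of _ "construct_game q"], rule exI[of _ "decode_partition q"],
    rule exI[of _ "40 * q\<^sup>2"], rule exI[of _ 4], rule exI[of _ "2 * q + 13"], intro allI impI)
  fix V :: "'a set" and w :: "'a \<Rightarrow> 'a \<Rightarrow> ereal" and vs :: "'a list"
  assume "coloring_game V w \<and> weights_in nat_weights V w \<and> distinct vs \<and> set vs = V"
  then have game: "coloring_game V w" "weights_in nat_weights V w"
    and vs: "numbered_players V vs" and n: "length vs = card V"
    by (auto simp: numbered_players_def distinct_card)
  define W where "W = rtab (game_input vs w) 0"
  have W: "W i j = w (vs ! i) (vs ! j)" if "i < length vs" "j < length vs" for i j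
    using that by (simp add: W_def game_input_def)
  define N where "N = length vs * q * (length vs + 1)"
  have "reg (game_input vs w) = (\<lambda>_. 0)(0 := length vs)" by (simp add: game_input_def)
  from terminates_construct_game[OF _ this, of q h] assms(1) obtain t s where
    run: "exec h (construct_game q) (game_input vs w) t s" "t \<le> 40 * q\<^sup>2 * (card V + 1) ^ 4"
    and size: "output_size s = N"
    and weight: "\<And>p r. p < N \<Longrightarrow> r < N \<Longrightarrow>
      output_weight s p r = new_weight h (length vs) q W p r"
    by (auto simp: terminates_def output_size_def output_weight_def N_def W_def n)
  have G': "slot_token_game q h V w (numbered_players.slot vs) (numbered_players.token vs q)
      {..<N} (output_weight s)"
    by (rule numbered_players.slot_token_game[OF vs assms(2,3) game W N_def weight])
  have "\<exists>t' s' C. exec h (decode_partition q) (partition_input (card V) xss) t' s' \<and>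
      t' \<le> (2 * q + 13) * (card {..<N} + 1) \<and>
      encodes_groups vs (output_groups s') C \<and> maximum_configuration q h V w C"
    if P: "maximum_partition {..<N} (output_weight s) P" "encodes_groups [0..<N] xss (mset_set P)" for P xss
  proof -
    have "length vs * q \<le> N" by (simp add: N_def)
    note decoded = encodes_groups_decoded[OF vs G' this P]
    obtain t' s' where "exec h (decode_partition q) (partition_input (card V) xss) t' s'"
      "t' \<le> Suc (Suc (\<Sum>xs\<leftarrow>xss. 6 + length xs * (2 * q + 7)))"
      "output_groups s' = map (slot_owners (card V) q) xss"
      using terminates_decode_partition[of h q "card V" xss] by (auto simp: terminates_def)
    \<comment> \<open>The \<open>+ 1\<close> in the bound absorbs the two steps outside the rounds
      of the decoding loop.\<close>
    then show ?thesis
      using decoded n by fastforce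
  qed
  then show "\<exists>t s. exec h (construct_game q) (game_input vs w) t s \<and>
      t \<le> 40 * q\<^sup>2 * (card V + 1) ^ 4 \<and>
      (let V' = {..<output_size s}; w' = output_weight s in
         coloring_game V' w' \<and>
         (\<forall>P xss. maximum_partition V' w' P \<and>
            encodes_groups [0..<output_size s] xss (mset_set P) \<longrightarrow>
            (\<exists>t' s' C. exec h (decode_partition q) (partition_input (card V) xss) t' s' \<and>
               t' \<le> (2 * q + 13) * (card V' + 1) \<and>
               encodes_groups vs (output_groups s') C \<and>
               maximum_configuration q h V w C)))"
    unfolding Let_def using run size slot_token_game.new_game[OF G'] by metis
qed

end
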